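(* Let $F:\mathbb{R}\to\mathbb{R}$ be continuously differentiable, $x_0\in\mathbb{R}$, $T>0$, $\alpha\in\mathbb{R}$ and $0<\varepsilon<\tfrac{T}{2}$. Consider the scalar system $$\dot{x}(t)=F(x(t))\,u_1(t)+u_2(t),\qquad x(0)=x_0,$$ with the $T$-periodic inputs given on one period by $$u_1(t)=\begin{cases}1 & t\in[0,\tfrac{T}{2})\\ -1 & t\in[\tfrac{T}{2},T)\end{cases},\qquad u_2(t)=\begin{cases}\alpha & t\in[0,\varepsilon)\\ 0 & t\in[\varepsilon,\tfrac{T}{2})\\ -\alpha & t\in[\tfrac{T}{2},\tfrac{T}{2}+\varepsilon)\\ 0 & t\in[\tfrac{T}{2}+\varepsilon,T).\end{cases}$$ Let $x^*(t)$ denote the solution of $\dot{x}^*(t)=F(x^*(t))u_1(t)$, $x^*(0)=x_0$ (i.e. the solution of the system for the same $u_1$ and $u_2\equiv 0$), and suppose that $x^*(t)$ exists on $[0,T]$. Let $\Phi(t,t_0)$ denote the state-transition matrix at time $t$, with initial time $t_0$, of the variational equation $$\dot{v}_1(t)=\tfrac{\partial F}{\partial x}\big(x^*(t)\big)\,v_1(t).$$ Then $$x(T)=x_0+\varepsilon\,\alpha\,\Phi(0,\varepsilon)\int_{\varepsilon}^{\frac{T}{2}-\varepsilon}\tfrac{\partial F}{\partial x}\big(x^*(\tau)\big)\,\Phi\big(\tau,\tfrac{T}{2}-\varepsilon\big)\,d\tau+\mathcal{O}(\varepsilon^2).$$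
   Context: Landau notation: $f(\varepsilon)=\mathcal{O}(g(\varepsilon))$ means that there exist $M>0$ and $\delta>0$ such that $|f(\varepsilon)|\le M|g(\varepsilon)|$ for all (admissible) $|\varepsilon|\le\delta$; here $F,x_0,T,\alpha$ are fixed and $\varepsilon$ is the small parameter. The state-transition matrix $\Phi(t,t_0)$ of a scalar linear time-varying equation $\dot v(t)=a(t)v(t)$ is the function such that every solution satisfies $v(t)=\Phi(t,t_0)v(t_0)$ (both $t\ge t_0$ and $t<t_0$ are allowed).
   Formalization: Added assumption: if F(x_0)=0, then F(x)-F'(x_0)(x-x_0)=O((x-x_0)^2) as x→x_0 (automatic for C^2 F); without it the claim fails, e.g. F(x)=|x|^{3/2}, x_0=0, T=2, α=1 gives x(T)~ε^{3/2}. *)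

theory Defs
  imports "HOL-Analysis.Analysis"
begin

text \<open>The factor \<open>T * frac (t / T)\<close> is the representative of \<open>t\<close> modulo \<open>T\<close> in \<open>{0..<T}\<close>.\<close>

definition u1 :: "real \<Rightarrow> real \<Rightarrow> real" where
  "u1 T t = (if T * frac (t / T) < T / 2 then 1 else - 1)"

definition u2 :: "real \<Rightarrow> real \<Rightarrow> real \<Rightarrow> real \<Rightarrow> real" where
  "u2 T \<alpha> \<epsilon> t =
    (let s = T * frac (t / T) in
      if s < \<epsilon> then \<alpha>
      else if s < T / 2 then 0
      else if s < T / 2 + \<epsilon> then - \<alpha>
      else 0)"

text \<open>Solutions on \<open>{0..T}\<close> of \<open>x' = F x * w1 + w2\<close> with \<open>x 0 = x0\<close>. As the inputs are only
  piecewise continuous, the equation is required away from a finite set of times, and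
  \<open>x\<close> is required to be continuous throughout.\<close>

definition system_solution ::
  "(real \<Rightarrow> real) \<Rightarrow> (real \<Rightarrow> real) \<Rightarrow> (real \<Rightarrow> real) \<Rightarrow> real \<Rightarrow> real \<Rightarrow> (real \<Rightarrow> real) \<Rightarrow> bool" where
  "system_solution F w1 w2 x0 T x \<longleftrightarrow>
    x 0 = x0 \<and> continuous_on {0..T} x \<and>
    (\<exists>S. finite S \<and>
      (\<forall>t\<in>{0..T} - S. (x has_real_derivative (F (x t) * w1 t + w2 t)) (at t within {0..T})))"

text \<open>\<open>\<Phi> t t0\<close> propagates every solution of \<open>v' = a v\<close> on \<open>I\<close> from \<open>t0\<close> to \<open>t\<close>,
  forwards or backwards in time.\<close>

definition state_transition ::
  "(real \<Rightarrow> real) \<Rightarrow> real set \<Rightarrow> (real \<Rightarrow> real \<Rightarrow> real) \<Rightarrow> bool" where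
  "state_transition a I \<Phi> \<longleftrightarrow>
    (\<forall>v. (\<forall>t\<in>I. (v has_real_derivative (a t * v t)) (at t within I)) \<longrightarrow>
      (\<forall>t\<in>I. \<forall>t0\<in>I. v t = \<Phi> t t0 * v t0))"

end

theory Submission
  imports Defs
begin

text \<open>Let \<open>A\<close> be a primitive of \<open>F' \<circ> xs\<close>, so that \<open>\<Phi> t t0 = exp (A t - A t0)\<close>. The integral in
  the claim is that of \<open>d\<Phi>/d\<tau>\<close>, so up to \<open>O(\<epsilon>\<^sup>2)\<close> the claim reads
  \<open>x T = x0 + \<epsilon> * \<alpha> * (1 - exp (A 0 - A (T / 2)))\<close>: the kick at time \<open>0\<close> is transported forth and
  back by the drift, the kick at time \<open>T / 2\<close> only back. If \<open>F x0 \<noteq> 0\<close>, then \<open>F\<close> has no zero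
  along \<open>xs\<close> and the drift is straightened by a primitive of \<open>1 / F\<close>. If \<open>F x0 = 0\<close>, then
  \<open>xs\<close> is constant and an integrating factor does the same, the nonlinear remainder being
  \<open>O(\<epsilon>\<^sup>2)\<close> by the hypothesis on \<open>F\<close> at \<open>x0\<close>. Solutions exist by Picard iteration for a
  truncation of \<open>F\<close> and stay \<open>O(\<epsilon>)\<close>-close to \<open>xs\<close> by Gronwall's inequality.\<close>

subsection \<open>Growth estimates with exceptional points\<close>

lemma increment_le:
  fixes f :: "real \<Rightarrow> real"
  assumes ab: "a \<le> b" and S: "finite S" and cont: "continuous_on {a..b} f"
    and D: "\<And>t. t \<in> {a<..<b} - S \<Longrightarrow> (f has_real_derivative f' t) (at t)"
    and le: "\<And>t. t \<in> {a<..<b} - S \<Longrightarrow> f' t \<le> B"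
  shows "f b - f a \<le> B * (b - a)"
proof -
  \<comment> \<open>At the exceptional points and at the ends \<open>f'\<close> is unconstrained;
    the default value \<open>B\<close> keeps the comparison of integrands true on all of
    \<open>{a..b}\<close>.\<close>
  define g where "g t = (if t \<in> {a<..<b} - S then f' t else B)" for t
  have "(g has_integral f b - f a) {a..b}"
    using D by (intro fundamental_theorem_of_calculus_interior_strong[OF S ab _ cont])
      (auto simp: g_def has_real_derivative_iff_has_vector_derivative)
  moreover have "((\<lambda>_. B) has_integral B * (b - a)) {a..b}"
    using has_integral_const_real[of B a b] ab by (simp add: mult.commute)
  ultimately show ?thesis
    by (rule has_integral_le) (auto simp: g_def le)
qed

text \<open>\<open>increment_le\<close> for \<open>f\<close> and for \<open>- f\<close>. The
  reference slope \<open>c\<close> serves two uses: \<open>c = 0\<close> yields Lipschitz bounds and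
  conserved quantities, \<open>c \<noteq> 0\<close> first-order expansions.\<close>

lemma increment_abs_le:
  fixes f :: "real \<Rightarrow> real"
  assumes ab: "a \<le> b" and S: "finite S" and cont: "continuous_on {a..b} f"
    and D: "\<And>t. t \<in> {a<..<b} - S \<Longrightarrow> (f has_real_derivative f' t) (at t)"
    and le: "\<And>t. t \<in> {a<..<b} - S \<Longrightarrow> \<bar>f' t - c\<bar> \<le> B"
  shows "\<bar>f b - f a - c * (b - a)\<bar> \<le> B * (b - a)"
proof -
  have "f b - f a \<le> (c + B) * (b - a)"
    using le by (intro increment_le[OF ab S cont D]) (auto simp: abs_le_iff algebra_simps)
  moreover have "- f b - (- f a) \<le> (B - c) * (b - a)"
    using le by (intro increment_le[OF ab S, where f' = "\<lambda>t. - f' t"])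
      (auto simp: abs_le_iff algebra_simps intro!: continuous_intros cont derivative_eq_intros D)
  ultimately show ?thesis
    by (simp add: abs_le_iff algebra_simps)
qed

lemma constant_if_deriv_zero:
  fixes f :: "real \<Rightarrow> real"
  assumes "a \<le> b" "finite S" "continuous_on {a..b} f"
    and "\<And>t. t \<in> {a<..<b} - S \<Longrightarrow> (f has_real_derivative 0) (at t)"
  shows "f b = f a"
  using increment_abs_le[OF assms, of 0 0] by simp

section \<open>Gronwall's inequality and Lipschitz bounds\<close>

definition gronwall_const :: "real \<Rightarrow> real \<Rightarrow> real" where
  "gronwall_const L T = sqrt (T * exp ((2 * L + 1) * T))"

text \<open>The square of \<open>e\<close> is estimated because, unlike
  \<open>\<bar>e\<bar>\<close>, it is differentiable where \<open>e\<close> vanishes. The resulting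
  constant is not sharp; what matters is that the bound is linear in \<open>c\<close>, which will be
  \<open>0\<close> for uniqueness and O(\<epsilon>) for closeness.\<close>

lemma gronwall:
  fixes e :: "real \<Rightarrow> real"
  assumes L: "0 \<le> L" and c: "0 \<le> c" and S: "finite S" and cont: "continuous_on {0..T} e"
    and e0: "e 0 = 0"
    and D: "\<And>t. t \<in> {0<..<T} - S \<Longrightarrow> (e has_real_derivative e' t) (at t)"
    and le: "\<And>t. t \<in> {0<..<T} - S \<Longrightarrow> \<bar>e' t\<bar> \<le> L * \<bar>e t\<bar> + c"
    and t: "t \<in> {0..T}"
  shows "\<bar>e t\<bar> \<le> c * gronwall_const L T"
proof -
  \<comment> \<open>The derivative of the square is at most
    \<open>2 * L * (e s)\<^sup>2 + 2 * c * \<bar>e s\<bar>\<close>, and the last term is at most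
    \<open>c\<^sup>2 + (e s)\<^sup>2\<close>. The weight with rate \<open>2 * L + 1\<close> absorbs
    both squares of \<open>e\<close> and leaves \<open>c\<^sup>2\<close>.\<close>
  define k where "k = 2 * L + 1"
  define h where "h s = (e s)\<^sup>2 * exp (- k * s)" for s
  have k: "0 < k" using L by (simp add: k_def)
  have "h t - h 0 \<le> c\<^sup>2 * (t - 0)"
  proof (rule increment_le[OF _ S])
    show "continuous_on {0..t} h"
      unfolding h_def using t
      by (intro continuous_intros continuous_on_subset[OF cont]) auto
    fix s assume s: "s \<in> {0<..<t} - S"
    then have s': "s \<in> {0<..<T} - S" using t by auto
    show "(h has_real_derivative (2 * e s * e' s - k * (e s)\<^sup>2) * exp (- k * s)) (at s)"
      unfolding h_def
      by (auto intro!: derivative_eq_intros D[OF s'] simp: algebra_simps power2_eq_square)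
    have "e s * e' s \<le> \<bar>e s\<bar> * (L * \<bar>e s\<bar> + c)"
      using mult_left_mono[OF le[OF s'], of "\<bar>e s\<bar>"] abs_ge_self[of "e s * e' s"]
      by (simp add: abs_mult)
    also have "\<dots> = L * (e s)\<^sup>2 + c * \<bar>e s\<bar>"
      by (simp add: algebra_simps power2_eq_square)
    also have "2 * (c * \<bar>e s\<bar>) \<le> c\<^sup>2 + (e s)\<^sup>2"
      using sum_squares_bound[of c "\<bar>e s\<bar>"] by simp
    ultimately have *: "2 * e s * e' s - k * (e s)\<^sup>2 \<le> c\<^sup>2"
      by (simp add: k_def algebra_simps)
    have "exp (- k * s) \<le> 1" using k s by simp
    have "(2 * e s * e' s - k * (e s)\<^sup>2) * exp (- k * s) \<le> c\<^sup>2 * exp (- k * s)"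
      using * by (intro mult_right_mono) auto
    also have "\<dots> \<le> c\<^sup>2 * 1"
      using \<open>exp (- k * s) \<le> 1\<close> by (intro mult_left_mono) auto
    finally show "(2 * e s * e' s - k * (e s)\<^sup>2) * exp (- k * s) \<le> c\<^sup>2" by simp
  qed (use t in auto)
  then have "(e t)\<^sup>2 * exp (- k * t) \<le> c\<^sup>2 * t" by (simp add: h_def e0)
  then have "(e t)\<^sup>2 \<le> c\<^sup>2 * t * exp (k * t)"
    by (simp add: exp_minus field_simps)
  also have "\<dots> \<le> c\<^sup>2 * (T * exp (k * T))"
    unfolding mult.assoc using t k by (intro mult_left_mono mult_mono) auto
  finally have "sqrt ((e t)\<^sup>2) \<le> sqrt (c\<^sup>2 * (T * exp (k * T)))"
    by (rule real_sqrt_le_mono)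
  then show ?thesis
    using c by (simp add: real_sqrt_mult gronwall_const_def k_def)
qed

lemma lipschitz_on_interval:
  fixes F :: "real \<Rightarrow> real"
  assumes D: "\<And>y. y \<in> {a..b} \<Longrightarrow> (F has_real_derivative F' y) (at y within {a..b})"
    and cont: "continuous_on {a..b} F'"
  obtains L where "0 < L" "\<And>y z. y \<in> {a..b} \<Longrightarrow> z \<in> {a..b} \<Longrightarrow> \<bar>F y - F z\<bar> \<le> L * \<bar>y - z\<bar>"
proof -
  have "bounded (F' ` {a..b})"
    using cont by (intro compact_imp_bounded compact_continuous_image) auto
  then obtain L where L: "0 < L" "\<And>y. y \<in> {a..b} \<Longrightarrow> \<bar>F' y\<bar> \<le> L"
    by (force simp: bounded_pos)
  have "\<bar>F y - F z\<bar> \<le> L * \<bar>y - z\<bar>" if "y \<in> {a..b}" "z \<in> {a..b}" for y z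
    using field_differentiable_bound[of "{a..b}" F F' L y z] that L D by auto
  with L(1) show ?thesis by (rule that)
qed

subsection \<open>The inputs and their primitives\<close>

lemma u1_eq: "0 \<le> t \<Longrightarrow> t < T \<Longrightarrow> u1 T t = (if t < T / 2 then 1 else - 1)"
  by (simp add: u1_def frac_eq)

lemma abs_u1: "\<bar>u1 T t\<bar> = 1"
  by (simp add: u1_def)

lemma u2_eq:
  "0 \<le> t \<Longrightarrow> t < T \<Longrightarrow> u2 T \<alpha> \<epsilon> t =
    (if t < \<epsilon> then \<alpha> else if t < T / 2 then 0 else if t < T / 2 + \<epsilon> then - \<alpha> else 0)"
  by (simp add: u2_def frac_eq)

text \<open>The tent-shaped primitive of \<open>u1\<close> on \<open>{0..T}\<close>: the net time
  for which the drift has run forwards. Its return to \<open>0\<close> at \<open>T\<close> is what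
  cancels the drift over a period.\<close>

definition U1 :: "real \<Rightarrow> real \<Rightarrow> real" where
  "U1 T t = min t (T - t)"

text \<open>The primitive of \<open>u2\<close> on \<open>{0..T}\<close>: the first clamp ramps up to
  \<open>\<alpha> * \<epsilon>\<close> during the first kick, the second takes this back during the
  kick after \<open>T / 2\<close>.\<close>

definition U2 :: "real \<Rightarrow> real \<Rightarrow> real \<Rightarrow> real \<Rightarrow> real" where
  "U2 T \<alpha> \<epsilon> t = \<alpha> * (min t \<epsilon> - max 0 (min (t - T / 2) \<epsilon>))"

lemma continuous_on_U1: "continuous_on A (U1 T)"
  unfolding U1_def by (intro continuous_intros)

lemma continuous_on_U2: "continuous_on A (U2 T \<alpha> \<epsilon>)"
  unfolding U2_def by (intro continuous_intros)

lemma U1_has_derivative: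
  assumes "t \<in> {0<..<T} - {T / 2}"
  shows "(U1 T has_real_derivative u1 T t) (at t)"
proof (cases "t < T / 2")
  case True
  then have "((\<lambda>t. t) has_real_derivative u1 T t) (at t)"
    using assms by (auto simp: u1_eq intro!: derivative_eq_intros)
  then show ?thesis
    by (rule has_field_derivative_transform_within_open[where S = "{..<T / 2}"])
      (use True in \<open>auto simp: U1_def\<close>)
next
  case False
  then have "((\<lambda>t. T - t) has_real_derivative u1 T t) (at t)"
    using assms by (auto simp: u1_eq intro!: derivative_eq_intros)
  then show ?thesis
    by (rule has_field_derivative_transform_within_open[where S = "{T / 2<..}"])
      (use False assms in \<open>auto simp: U1_def\<close>)
qed

lemma U2_has_derivative:
  assumes \<epsilon>: "0 < \<epsilon>" "\<epsilon> < T / 2" and t: "t \<in> {0<..<T} - {\<epsilon>, T / 2, T / 2 + \<epsilon>}"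
  shows "(U2 T \<alpha> \<epsilon> has_real_derivative u2 T \<alpha> \<epsilon> t) (at t)"
proof -
  consider "t < \<epsilon>" | "\<epsilon> < t" "t < T / 2" | "T / 2 < t" "t < T / 2 + \<epsilon>" | "T / 2 + \<epsilon> < t"
    using t by fastforce
  then show ?thesis
  proof cases
    case 1
    then have "((\<lambda>t. \<alpha> * t) has_real_derivative u2 T \<alpha> \<epsilon> t) (at t)"
      using t \<epsilon> by (auto simp: u2_eq intro!: derivative_eq_intros)
    then show ?thesis
      by (rule has_field_derivative_transform_within_open[where S = "{..<\<epsilon>}"])
        (use 1 \<epsilon> in \<open>auto simp: U2_def\<close>)
  next
    case 2
    then have "((\<lambda>t. \<alpha> * \<epsilon>) has_real_derivative u2 T \<alpha> \<epsilon> t) (at t)"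
      using t \<epsilon> by (auto simp: u2_eq intro!: derivative_eq_intros)
    then show ?thesis
      by (rule has_field_derivative_transform_within_open[where S = "{\<epsilon><..<T / 2}"])
        (use 2 \<epsilon> in \<open>auto simp: U2_def\<close>)
  next
    case 3
    then have "((\<lambda>t. \<alpha> * (\<epsilon> - (t - T / 2))) has_real_derivative u2 T \<alpha> \<epsilon> t) (at t)"
      using t \<epsilon> by (auto simp: u2_eq intro!: derivative_eq_intros)
    then show ?thesis
      by (rule has_field_derivative_transform_within_open[where S = "{T / 2<..<T / 2 + \<epsilon>}"])
        (use 3 \<epsilon> in \<open>auto simp: U2_def\<close>)
  next
    case 4
    then have "((\<lambda>t. 0) has_real_derivative u2 T \<alpha> \<epsilon> t) (at t)"
      using t \<epsilon> by (auto simp: u2_eq intro!: derivative_eq_intros)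
    then show ?thesis
      by (rule has_field_derivative_transform_within_open[where S = "{T / 2 + \<epsilon><..}"])
        (use 4 \<epsilon> in \<open>auto simp: U2_def\<close>)
  qed
qed

lemma abs_U2_le: "0 < \<epsilon> \<Longrightarrow> \<epsilon> < T / 2 \<Longrightarrow> 0 \<le> t \<Longrightarrow> \<bar>U2 T \<alpha> \<epsilon> t\<bar> \<le> \<bar>\<alpha>\<bar> * \<epsilon>"
  unfolding U2_def abs_mult by (intro mult_left_mono) auto

subsection \<open>Existence and uniqueness of solutions\<close>

lemma system_solutionE:
  assumes "system_solution F w1 w2 x0 T x"
  obtains S where "finite S" "continuous_on {0..T} x" "x 0 = x0"
    "\<And>t. t \<in> {0<..<T} - S \<Longrightarrow> (x has_real_derivative (F (x t) * w1 t + w2 t)) (at t)"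
proof -
  obtain S where S: "finite S" "\<And>t. t \<in> {0..T} - S \<Longrightarrow>
      (x has_real_derivative (F (x t) * w1 t + w2 t)) (at t within {0..T})"
    using assms unfolding system_solution_def by blast
  show ?thesis
  proof (rule that[OF S(1)])
    fix t assume t: "t \<in> {0<..<T} - S"
    then show "(x has_real_derivative (F (x t) * w1 t + w2 t)) (at t)"
      using S(2)[of t] by (simp add: at_within_Icc_at)
  qed (use assms in \<open>auto simp: system_solution_def\<close>)
qed

lemma system_solutionI:
  assumes "finite S" "continuous_on {0..T} x" "x 0 = x0"
    "\<And>t. t \<in> {0<..<T} - S \<Longrightarrow> (x has_real_derivative (F (x t) * w1 t + w2 t)) (at t)"
  shows "system_solution F w1 w2 x0 T x"
  unfolding system_solution_def
  \<comment> \<open>The two endpoints join the exceptional set, so that two-sided derivatives in the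
    interior suffice.\<close>
  using assms by (intro conjI exI[of _ "S \<union> {0, T}"])
    (force intro: has_field_derivative_at_within)+

lemma system_solution_cong:
  assumes "\<And>t. t \<in> {0..T} \<Longrightarrow> F (x t) = G (x t)"
  shows "system_solution F w1 w2 x0 T x \<longleftrightarrow> system_solution G w1 w2 x0 T x"
  unfolding system_solution_def using assms
  by (intro conj_cong refl arg_cong[where f = Ex] ext ball_cong) auto

text \<open>Both trajectories are bounded by compactness, and \<open>F\<close> is Lipschitz on a
  common interval around them. The input \<open>w2\<close> drops out of the difference, so Gronwall
  applies with \<open>c = 0\<close>.\<close>

lemma system_solution_unique:
  assumes D: "\<And>y. (F has_real_derivative F' y) (at y)" and cont: "continuous_on UNIV F'"
    and w1: "\<And>t. \<bar>w1 t\<bar> \<le> 1"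
    and x: "system_solution F w1 w2 x0 T x" and y: "system_solution F w1 w2 x0 T y"
    and t: "t \<in> {0..T}"
  shows "x t = y t"
proof -
  obtain S where S: "finite S" "continuous_on {0..T} x" "x 0 = x0"
    "\<And>t. t \<in> {0<..<T} - S \<Longrightarrow> (x has_real_derivative (F (x t) * w1 t + w2 t)) (at t)"
    using x by (elim system_solutionE) blast
  obtain S' where S': "finite S'" "continuous_on {0..T} y" "y 0 = x0"
    "\<And>t. t \<in> {0<..<T} - S' \<Longrightarrow> (y has_real_derivative (F (y t) * w1 t + w2 t)) (at t)"
    using y by (elim system_solutionE) blast
  have "bounded (x ` {0..T} \<union> y ` {0..T})"
    using S S' by (auto intro!: compact_imp_bounded compact_continuous_image)
  then obtain N where N: "\<And>t. t \<in> {0..T} \<Longrightarrow> \<bar>x t\<bar> \<le> N \<and> \<bar>y t\<bar> \<le> N"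
    by (force simp: bounded_iff)
  obtain L where L: "0 < L" "\<And>y z. y \<in> {-N..N} \<Longrightarrow> z \<in> {-N..N} \<Longrightarrow> \<bar>F y - F z\<bar> \<le> L * \<bar>y - z\<bar>"
    by (rule lipschitz_on_interval[OF has_field_derivative_at_within[OF D] continuous_on_subset[OF cont],
          where a = "-N" and b = N]) auto
  have "\<bar>x t - y t\<bar> \<le> 0 * gronwall_const L T"
  proof (rule gronwall[where S = "S \<union> S'" and e = "\<lambda>t. x t - y t"
        and e' = "\<lambda>t. (F (x t) - F (y t)) * w1 t"])
    fix t assume t: "t \<in> {0<..<T} - (S \<union> S')"
    show "((\<lambda>t. x t - y t) has_real_derivative (F (x t) - F (y t)) * w1 t) (at t)"
      using t by (auto intro!: derivative_eq_intros S S' simp: algebra_simps)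
    have "\<bar>F (x t) - F (y t)\<bar> * \<bar>w1 t\<bar> \<le> L * \<bar>x t - y t\<bar> * 1"
      using N[of t] t w1 L(1) by (intro mult_mono L(2)) (auto simp: abs_le_iff)
    then show "\<bar>(F (x t) - F (y t)) * w1 t\<bar> \<le> L * \<bar>x t - y t\<bar> + 0"
      by (simp add: abs_mult)
  qed (use S S' t L in \<open>auto intro!: continuous_intros\<close>)
  then show ?thesis by simp
qed

section \<open>Existence by Picard iteration\<close>

lemma u1_isCont:
  assumes "t \<in> {0<..<T} - {T / 2}"
  shows "isCont (u1 T) t"
proof (cases "t < T / 2")
  case True
  have "((\<lambda>_. 1) has_real_derivative 0) (at t)" by simp
  then have "(u1 T has_real_derivative 0) (at t)"
    by (rule has_field_derivative_transform_within_open[where S = "{0<..<T / 2}"])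
      (use True assms in \<open>auto simp: u1_eq\<close>)
  then show ?thesis by (rule DERIV_isCont)
next
  case False
  have "((\<lambda>_. - 1) has_real_derivative 0) (at t)" by simp
  then have "(u1 T has_real_derivative 0) (at t)"
    by (rule has_field_derivative_transform_within_open[where S = "{T / 2<..<T}"])
      (use False assms in \<open>auto simp: u1_eq\<close>)
  then show ?thesis by (rule DERIV_isCont)
qed

text \<open>On each half \<open>u1\<close> is constant except at the right end, where it already has
  the value of the next half: \<open>- 1\<close> at \<open>T / 2\<close>, and \<open>1\<close> at
  \<open>T\<close> by periodicity. One point does not affect integrability.\<close>

lemma mult_u1_integrable:
  assumes T: "0 < T" and h: "continuous_on {0..T} h"
  shows "(\<lambda>t. h t * u1 T t) integrable_on {0..T}"
proof (rule Henstock_Kurzweil_Integration.integrable_combine[where c = "T / 2"])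
  have "h integrable_on {0..T / 2}"
    by (rule integrable_continuous_interval, rule continuous_on_subset[OF h]) (use T in auto)
  then show "(\<lambda>t. h t * u1 T t) integrable_on {0..T / 2}"
    by (rule integrable_spike_finite[where S = "{T / 2}", rotated 2]) (auto simp: u1_eq)
  have "(\<lambda>t. - h t) integrable_on {T / 2..T}"
    by (intro integrable_continuous_interval continuous_intros, rule continuous_on_subset[OF h])
      (use T in auto)
  then show "(\<lambda>t. h t * u1 T t) integrable_on {T / 2..T}"
    by (rule integrable_spike_finite[where S = "{T}", rotated 2]) (use T in \<open>auto simp: u1_eq\<close>)
qed (use T in auto)

text \<open>The Picard operator is a contraction in the norm with weight \<open>exp (- (2 * L + 1) * t)\<close>.\<close>

lemma integral_equation_solvable:
  fixes g s U :: "real \<Rightarrow> real"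
  assumes lip: "L-lipschitz_on UNIV g" and T: "0 \<le> T" and s: "\<And>t. \<bar>s t\<bar> \<le> 1"
    and int: "\<And>h. continuous_on {0..T} h \<Longrightarrow> (\<lambda>t. h t * s t) integrable_on {0..T}"
    and U: "continuous_on {0..T} U"
  obtains x where "continuous_on {0..T} x"
    "\<And>t. t \<in> {0..T} \<Longrightarrow> x t = U t + integral {0..t} (\<lambda>\<tau>. g (x \<tau>) * s \<tau>)"
proof -
  define K where "K = 2 * L + 1"
  have L: "0 \<le> L" using lip by (rule lipschitz_on_nonneg)
  then have K: "0 < K" by (simp add: K_def)
  have g: "continuous_on A g" for A
    using lipschitz_on_continuous_on[OF lip] by (rule continuous_on_subset) simp
  \<comment> \<open>The unknown is rescaled by \<open>x t = exp (K * t) * y t\<close>; this turns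
    the weighted norm of \<open>x\<close> into the plain supremum norm of \<open>y\<close>, so that
    Banach's theorem applies to bounded continuous functions.\<close>
  define f where "f y \<tau> = g (exp (K * \<tau>) * y \<tau>) * s \<tau>" for y :: "real \<Rightarrow>\<^sub>C real" and \<tau>
  define Op where "Op y t = exp (- K * t) * (U t + integral {0..t} (f y))" for y t
  have f_int: "f y integrable_on {0..T}" for y
    unfolding f_def by (intro int continuous_on_compose2[OF g[of UNIV]] continuous_intros) auto
  have f_int': "f y integrable_on {0..t}" if "t \<in> {0..T}" for y t
    using that by (intro integrable_on_subinterval[OF f_int]) auto
  have "continuous_on {0..T} (Op y)" for y
    unfolding Op_def by (intro continuous_intros U indefinite_integral_continuous_1 f_int)
  \<comment> \<open>Clamping the time to \<open>{0..T}\<close> extends \<open>Op y\<close> to a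
    bounded continuous function on the whole line.\<close>
  then have "\<exists>z :: real \<Rightarrow>\<^sub>C real. \<forall>t. z t = Op y (clamp 0 T t)" for y
    using continuous_on_cbox_bcontfunE[of 0 T "Op y"] by (metis cbox_interval)
  then obtain P :: "(real \<Rightarrow>\<^sub>C real) \<Rightarrow> (real \<Rightarrow>\<^sub>C real)"
    where P: "\<And>y t. P y t = Op y (clamp 0 T t)" by metis
  have "dist (P y) (P z) \<le> 1 / 2 * dist y z" for y z
  proof (rule dist_bound)
    fix t
    define r where "r = clamp 0 T t"
    have r: "r \<in> {0..T}"
      using clamp_in_interval[of 0 T t] T by (simp add: r_def)
    define d where "d = dist y z"
    have d: "0 \<le> d" by (simp add: d_def)
    have "((\<lambda>\<tau>. L * d * exp (K * \<tau>)) has_integral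
        L * d * exp (K * r) / K - L * d * exp (K * 0) / K) {0..r}"
      using r K by (intro fundamental_theorem_of_calculus)
        (auto simp: has_real_derivative_iff_has_vector_derivative[symmetric]
          intro!: derivative_eq_intros)
    moreover have "norm (f y \<tau> - f z \<tau>) \<le> L * d * exp (K * \<tau>)" for \<tau>
    proof -
      have "\<bar>f y \<tau> - f z \<tau>\<bar> = \<bar>g (exp (K * \<tau>) * y \<tau>) - g (exp (K * \<tau>) * z \<tau>)\<bar> * \<bar>s \<tau>\<bar>"
        by (simp add: f_def abs_mult[symmetric] left_diff_distrib)
      also have "\<dots> \<le> (L * \<bar>exp (K * \<tau>) * y \<tau> - exp (K * \<tau>) * z \<tau>\<bar>) * 1"
        using lipschitz_onD[OF lip, of "exp (K * \<tau>) * y \<tau>" "exp (K * \<tau>) * z \<tau>"] L s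
        by (intro mult_mono) (auto simp: dist_real_def)
      also have "\<dots> = L * (exp (K * \<tau>) * \<bar>y \<tau> - z \<tau>\<bar>)"
        by (simp add: right_diff_distrib[symmetric] abs_mult)
      also have "\<dots> \<le> L * (exp (K * \<tau>) * d)"
        using L dist_bounded[of y \<tau> z] by (intro mult_left_mono) (auto simp: d_def dist_real_def)
      finally show ?thesis by (simp add: mult_ac)
    qed
    ultimately have "norm (integral {0..r} (\<lambda>\<tau>. f y \<tau> - f z \<tau>)) \<le> L * d * exp (K * r) / K - L * d / K"
      using integral_norm_bound_integral[of "\<lambda>\<tau>. f y \<tau> - f z \<tau>" "{0..r}" "\<lambda>\<tau>. L * d * exp (K * \<tau>)"]
        f_int'[OF r] by (auto simp: integrable_diff has_integral_iff)
    also have "\<dots> \<le> L * d * exp (K * r) / K"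
      using L d K by simp
    finally have "exp (- K * r) * norm (integral {0..r} (\<lambda>\<tau>. f y \<tau> - f z \<tau>))
        \<le> exp (- K * r) * (L * d * exp (K * r) / K)"
      by (intro mult_left_mono) auto
    also have "\<dots> = L / K * d"
      by (simp add: exp_minus field_simps)
    \<comment> \<open>Integrating the exponential weight has produced the factor
      \<open>L / K\<close>, which is below \<open>1 / 2\<close> since
      \<open>K = 2 * L + 1\<close>.\<close>
    also have "\<dots> \<le> 1 / 2 * d"
      using L d by (intro mult_right_mono) (auto simp: K_def field_simps)
    also have "exp (- K * r) * norm (integral {0..r} (\<lambda>\<tau>. f y \<tau> - f z \<tau>)) = dist (P y t) (P z t)"
      using f_int'[OF r]
      by (simp add: P Op_def r_def[symmetric] dist_real_def right_diff_distrib[symmetric]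
          abs_mult integral_diff)
    finally show "dist (P y t) (P z t) \<le> 1 / 2 * dist y z" by (simp add: d_def)
  qed
  then obtain y where y: "P y = y"
    using banach_fix_type[of "1 / 2" P] by auto
  define x where "x t = exp (K * t) * y t" for t
  show ?thesis
  proof (rule that)
    show "continuous_on {0..T} x"
      unfolding x_def by (intro continuous_intros) auto
    fix t assume t: "t \<in> {0..T}"
    then have "y t = Op y t"
      using P[of y t] clamp_cancel_cbox[of t 0 T] by (simp add: y)
    then show "x t = U t + integral {0..t} (\<lambda>\<tau>. g (x \<tau>) * s \<tau>)"
      by (simp add: x_def Op_def f_def[abs_def] exp_minus)
  qed
qed

text \<open>In integrated form the discontinuous \<open>u2\<close> becomes the continuous forcing
  \<open>U2\<close>, and Picard iteration applies. Away from the switching times the integrand is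
  continuous, so the integral equation can be differentiated back.\<close>

lemma system_solution_exists:
  assumes lip: "L-lipschitz_on UNIV g" and \<epsilon>: "0 < \<epsilon>" "\<epsilon> < T / 2"
  shows "\<exists>x. system_solution g (u1 T) (u2 T \<alpha> \<epsilon>) x0 T x"
proof -
  have T: "0 < T" using \<epsilon> by simp
  have g: "continuous_on A g" for A
    using lipschitz_on_continuous_on[OF lip] by (rule continuous_on_subset) simp
  obtain x where x: "continuous_on {0..T} x"
    "\<And>t. t \<in> {0..T} \<Longrightarrow> x t = x0 + U2 T \<alpha> \<epsilon> t + integral {0..t} (\<lambda>\<tau>. g (x \<tau>) * u1 T \<tau>)"
    by (rule integral_equation_solvable[OF lip, of T "u1 T" "\<lambda>t. x0 + U2 T \<alpha> \<epsilon> t"])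
      (use T in \<open>auto intro!: mult_u1_integrable continuous_intros continuous_on_U2 simp: abs_u1\<close>)
  have int: "(\<lambda>\<tau>. g (x \<tau>) * u1 T \<tau>) integrable_on {0..T}"
    by (intro mult_u1_integrable T continuous_on_compose2[OF g[of UNIV] x(1)]) simp
  have "system_solution g (u1 T) (u2 T \<alpha> \<epsilon>) x0 T x"
  proof (rule system_solutionI[where S = "{\<epsilon>, T / 2, T / 2 + \<epsilon>}"])
    show "x 0 = x0" using x(2)[of 0] \<epsilon> T by (simp add: U2_def)
    fix t assume t: "t \<in> {0<..<T} - {\<epsilon>, T / 2, T / 2 + \<epsilon>}"
    have "isCont x t"
      using continuous_on_interior[OF x(1)] t by simp
    moreover have "isCont g (x t)"
      using g[of UNIV] by (simp add: continuous_on_eq_continuous_at)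
    ultimately have "isCont (\<lambda>\<tau>. g (x \<tau>)) t"
      by (rule isCont_o2)
    then have "isCont (\<lambda>\<tau>. g (x \<tau>) * u1 T \<tau>) t"
      using t by (intro isCont_mult u1_isCont) auto
    then have "((\<lambda>t. integral {0..t} (\<lambda>\<tau>. g (x \<tau>) * u1 T \<tau>)) has_vector_derivative
        g (x t) * u1 T t) (at t within {0..T} - {})"
      using t by (intro integral_has_vector_derivative_continuous_at[OF int])
        (auto intro: continuous_at_imp_continuous_at_within)
    then have "((\<lambda>t. integral {0..t} (\<lambda>\<tau>. g (x \<tau>) * u1 T \<tau>)) has_real_derivative
        g (x t) * u1 T t) (at t)"
      using t by (simp add: has_real_derivative_iff_has_vector_derivative at_within_Icc_at)
    then have "((\<lambda>t. x0 + U2 T \<alpha> \<epsilon> t + integral {0..t} (\<lambda>\<tau>. g (x \<tau>) * u1 T \<tau>))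
        has_real_derivative g (x t) * u1 T t + u2 T \<alpha> \<epsilon> t) (at t)"
      using t \<epsilon> by (auto intro!: derivative_eq_intros U2_has_derivative)
    then show "(x has_real_derivative g (x t) * u1 T t + u2 T \<alpha> \<epsilon> t) (at t)"
      by (rule has_field_derivative_transform_within_open[where S = "{0<..<T}"])
        (use t x(2) in auto)
  qed (use x in auto)
  then show ?thesis by blast
qed

text \<open>The input \<open>u2\<close> is of order 1, but its primitive is O(\<epsilon>).
  Subtracting \<open>U2\<close> from \<open>x - xs\<close> removes \<open>u2\<close> from the
  equation and leaves a defect \<open>L * (\<bar>\<alpha>\<bar> * \<epsilon>)\<close> for
  Gronwall.\<close>

lemma system_solution_close:
  assumes lip: "L-lipschitz_on UNIV g" and \<epsilon>: "0 < \<epsilon>" "\<epsilon> < T / 2"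
    and xs: "system_solution g (u1 T) (\<lambda>t. 0) x0 T xs"
    and x: "system_solution g (u1 T) (u2 T \<alpha> \<epsilon>) x0 T x"
    and t: "t \<in> {0..T}"
  shows "\<bar>x t - xs t\<bar> \<le> \<bar>\<alpha>\<bar> * (1 + L * gronwall_const L T) * \<epsilon>"
proof -
  obtain S where S: "finite S" "continuous_on {0..T} xs" "xs 0 = x0"
    "\<And>t. t \<in> {0<..<T} - S \<Longrightarrow> (xs has_real_derivative (g (xs t) * u1 T t + 0)) (at t)"
    using xs by (elim system_solutionE) blast
  obtain S' where S': "finite S'" "continuous_on {0..T} x" "x 0 = x0"
    "\<And>t. t \<in> {0<..<T} - S' \<Longrightarrow>
      (x has_real_derivative (g (x t) * u1 T t + u2 T \<alpha> \<epsilon> t)) (at t)"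
    using x by (elim system_solutionE) blast
  have L: "0 \<le> L" using lip by (rule lipschitz_on_nonneg)
  define z where "z t = x t - xs t - U2 T \<alpha> \<epsilon> t" for t
  have "\<bar>z t\<bar> \<le> (L * (\<bar>\<alpha>\<bar> * \<epsilon>)) * gronwall_const L T"
  proof (rule gronwall[where S = "S \<union> S' \<union> {\<epsilon>, T / 2, T / 2 + \<epsilon>}" and e = z
        and e' = "\<lambda>t. (g (x t) - g (xs t)) * u1 T t"])
    show "continuous_on {0..T} z"
      unfolding z_def by (intro continuous_intros S S' continuous_on_U2)
    show "z 0 = 0" using S S' \<epsilon> by (simp add: z_def U2_def)
    fix t assume t: "t \<in> {0<..<T} - (S \<union> S' \<union> {\<epsilon>, T / 2, T / 2 + \<epsilon>})"
    show "(z has_real_derivative (g (x t) - g (xs t)) * u1 T t) (at t)"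
      unfolding z_def using t \<epsilon>
      by (auto intro!: derivative_eq_intros S(4) S'(4) U2_has_derivative simp: algebra_simps)
    have "\<bar>(g (x t) - g (xs t)) * u1 T t\<bar> \<le> L * \<bar>x t - xs t\<bar>"
      using lipschitz_onD[OF lip, of "x t" "xs t"] by (simp add: abs_mult abs_u1 dist_real_def)
    also have "\<dots> \<le> L * (\<bar>z t\<bar> + \<bar>\<alpha>\<bar> * \<epsilon>)"
      using abs_U2_le[OF \<epsilon>, of t \<alpha>] t L by (intro mult_left_mono) (auto simp: z_def)
    finally show "\<bar>(g (x t) - g (xs t)) * u1 T t\<bar> \<le> L * \<bar>z t\<bar> + L * (\<bar>\<alpha>\<bar> * \<epsilon>)"
      by (simp add: algebra_simps)
  qed (use S S' t L \<epsilon> in auto)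
  moreover have "\<bar>x t - xs t\<bar> \<le> \<bar>z t\<bar> + \<bar>\<alpha>\<bar> * \<epsilon>"
    using abs_U2_le[OF \<epsilon>, of t \<alpha>] t by (auto simp: z_def)
  ultimately show ?thesis by (simp add: algebra_simps)
qed

text \<open>\<open>F\<close> may grow arbitrarily, so its argument is first clamped to a band
  reaching one unit beyond the range of \<open>xs\<close>; the result \<open>g\<close> is globally
  Lipschitz. For small \<epsilon> the solution for \<open>g\<close> stays in the band, hence solves
  the original system, and uniqueness passes the estimate on to every solution.\<close>

lemma perturbed_solution:
  assumes D: "\<And>y. (F has_real_derivative F' y) (at y)" and cont: "continuous_on UNIV F'"
    and T: "0 < T" and xs: "system_solution F (u1 T) (\<lambda>t. 0) x0 T xs"
  obtains K \<delta> where "0 < K" "0 < \<delta>"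
    "\<And>\<epsilon>. 0 < \<epsilon> \<Longrightarrow> \<epsilon> < T / 2 \<Longrightarrow> \<epsilon> \<le> \<delta> \<Longrightarrow> \<exists>x. system_solution F (u1 T) (u2 T \<alpha> \<epsilon>) x0 T x"
    "\<And>\<epsilon> x t. 0 < \<epsilon> \<Longrightarrow> \<epsilon> < T / 2 \<Longrightarrow> \<epsilon> \<le> \<delta> \<Longrightarrow> system_solution F (u1 T) (u2 T \<alpha> \<epsilon>) x0 T x \<Longrightarrow>
      t \<in> {0..T} \<Longrightarrow> \<bar>x t - xs t\<bar> \<le> K * \<epsilon>"
proof -
  have "continuous_on {0..T} xs" using xs by (auto simp: system_solution_def)
  then have "bounded (xs ` {0..T})"
    by (auto intro!: compact_imp_bounded compact_continuous_image)
  then obtain N where N: "\<And>t. t \<in> {0..T} \<Longrightarrow> \<bar>xs t\<bar> \<le> N"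
    by (force simp: bounded_iff)
  have N0: "0 \<le> N" using N[of 0] T by simp
  define g where "g y = F (max (- (N + 1)) (min (N + 1) y))" for y
  have g_eq: "g y = F y" if "\<bar>y\<bar> \<le> N + 1" for y
    using that by (auto simp: g_def max_def min_def)
  obtain L where L: "0 < L" "\<And>y z. y \<in> {-(N + 1)..N + 1} \<Longrightarrow> z \<in> {-(N + 1)..N + 1} \<Longrightarrow>
      \<bar>F y - F z\<bar> \<le> L * \<bar>y - z\<bar>"
    by (rule lipschitz_on_interval[OF has_field_derivative_at_within[OF D] continuous_on_subset[OF cont],
          where a = "-(N + 1)" and b = "N + 1"]) auto
  have lip: "L-lipschitz_on UNIV g"
  proof (rule lipschitz_onI)
    fix y z
    have "\<bar>g y - g z\<bar> \<le> L * \<bar>max (- (N + 1)) (min (N + 1) y) - max (- (N + 1)) (min (N + 1) z)\<bar>"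
      unfolding g_def using N0 by (intro L(2)) auto
    also have "\<dots> \<le> L * \<bar>y - z\<bar>"
      using L(1) by (intro mult_left_mono) (auto simp: max_def min_def)
    finally show "dist (g y) (g z) \<le> L * dist y z" by (simp add: dist_real_def)
  qed (use L in auto)
  have xs': "system_solution g (u1 T) (\<lambda>t. 0) x0 T xs"
    using xs system_solution_cong[of T g xs F] N by (force simp: g_eq)
  \<comment> \<open>The summand \<open>1\<close> keeps \<open>K\<close> positive even for
    \<open>\<alpha> = 0\<close>; with \<open>\<epsilon> \<le> 1 / K\<close> the deviation
    \<open>K * \<epsilon>\<close> is at most the unit margin of the band.\<close>
  define K where "K = \<bar>\<alpha>\<bar> * (1 + L * gronwall_const L T) + 1"
  have "0 \<le> gronwall_const L T" using T by (simp add: gronwall_const_def)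
  then have K: "0 < K"
    unfolding K_def using L(1) by (intro add_nonneg_pos mult_nonneg_nonneg) auto
  have main: "\<exists>y. system_solution F (u1 T) (u2 T \<alpha> \<epsilon>) x0 T y \<and> (\<forall>t\<in>{0..T}. \<bar>y t - xs t\<bar> \<le> K * \<epsilon>)"
    if \<epsilon>: "0 < \<epsilon>" "\<epsilon> < T / 2" "\<epsilon> \<le> 1 / K" for \<epsilon>
  proof -
    obtain y where y: "system_solution g (u1 T) (u2 T \<alpha> \<epsilon>) x0 T y"
      using system_solution_exists[OF lip \<epsilon>(1,2)] by blast
    have close: "\<bar>y t - xs t\<bar> \<le> K * \<epsilon>" if "t \<in> {0..T}" for t
      using system_solution_close[OF lip \<epsilon>(1,2) xs' y that] \<epsilon>(1) by (simp add: K_def algebra_simps)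
    have "K * \<epsilon> \<le> 1" using \<epsilon> K by (simp add: field_simps)
    then have "\<bar>y t\<bar> \<le> N + 1" if "t \<in> {0..T}" for t
      using close[OF that] N[OF that] by linarith
    then have "system_solution F (u1 T) (u2 T \<alpha> \<epsilon>) x0 T y"
      using y system_solution_cong[of T g y F] by (simp add: g_eq)
    with close show ?thesis by blast
  qed
  show ?thesis
  proof (rule that[OF K, of "1 / K"])
    fix \<epsilon> x t
    assume \<epsilon>: "0 < \<epsilon>" "\<epsilon> < T / 2" "\<epsilon> \<le> 1 / K" and x: "system_solution F (u1 T) (u2 T \<alpha> \<epsilon>) x0 T x"
      and t: "t \<in> {0..T}"
    obtain y where y: "system_solution F (u1 T) (u2 T \<alpha> \<epsilon>) x0 T y" "\<bar>y t - xs t\<bar> \<le> K * \<epsilon>"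
      using main[OF \<epsilon>] t by blast
    moreover have "x t = y t"
      by (rule system_solution_unique[OF D cont _ x y(1) t]) (simp add: abs_u1)
    ultimately show "\<bar>x t - xs t\<bar> \<le> K * \<epsilon>" by simp
  qed (use K main in auto)
qed

subsection \<open>First-order response\<close>

text \<open>Meant for a coordinate \<open>h\<close> in which the drift is gone up to
  \<open>\<rho>\<close>. Freezing \<open>c\<close> at \<open>c0\<close> and \<open>c1\<close> costs
  O(\<epsilon>) on each kick, which lasts for time \<epsilon>; \<open>\<rho>\<close> costs
  O(\<epsilon>^2) over the whole period. Opposite kicks give the difference
  \<open>c0 - c1\<close>.\<close>

lemma kick_response:
  fixes h c \<rho> :: "real \<Rightarrow> real"
  assumes \<epsilon>: "0 < \<epsilon>" "\<epsilon> < T / 2" and S: "finite S" and cont: "continuous_on {0..T} h"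
    and D: "\<And>t. t \<in> {0<..<T} - S \<Longrightarrow>
      (h has_real_derivative c t * u2 T \<alpha> \<epsilon> t + \<rho> t) (at t)"
    and \<rho>: "\<And>t. t \<in> {0..T} \<Longrightarrow> \<bar>\<rho> t\<bar> \<le> B * \<epsilon>\<^sup>2"
    and c0: "\<And>t. t \<in> {0..\<epsilon>} \<Longrightarrow> \<bar>c t - c0\<bar> \<le> B * \<epsilon>"
    and c1: "\<And>t. t \<in> {T / 2..T / 2 + \<epsilon>} \<Longrightarrow> \<bar>c t - c1\<bar> \<le> B * \<epsilon>"
  shows "\<bar>h T - h 0 - \<alpha> * \<epsilon> * (c0 - c1)\<bar> \<le> B * (2 * \<bar>\<alpha>\<bar> + T) * \<epsilon>\<^sup>2"
proof -
  \<comment> \<open>The factor \<open>\<bar>\<beta>\<bar>\<close> on both sides of the hypothesis on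
    \<open>\<gamma>\<close> makes it void where the input is zero, so one estimate covers kicks and
    pauses.\<close>
  have piece: "\<bar>h b - h a - \<gamma> * \<beta> * (b - a)\<bar> \<le> (\<bar>\<beta>\<bar> * (B * \<epsilon>) + B * \<epsilon>\<^sup>2) * (b - a)"
    if ab: "0 \<le> a" "a \<le> b" "b \<le> T" and u: "\<And>t. t \<in> {a<..<b} \<Longrightarrow> u2 T \<alpha> \<epsilon> t = \<beta>"
      and \<gamma>: "\<And>t. t \<in> {a<..<b} \<Longrightarrow> \<bar>\<beta>\<bar> * \<bar>c t - \<gamma>\<bar> \<le> \<bar>\<beta>\<bar> * (B * \<epsilon>)" for a b \<beta> \<gamma>
  proof (rule increment_abs_le[OF ab(2) S])
    show "continuous_on {a..b} h" using ab by (intro continuous_on_subset[OF cont]) auto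
    fix t assume t: "t \<in> {a<..<b} - S"
    show "(h has_real_derivative c t * u2 T \<alpha> \<epsilon> t + \<rho> t) (at t)"
      using t ab by (intro D) auto
    have "c t * u2 T \<alpha> \<epsilon> t + \<rho> t - \<gamma> * \<beta> = \<beta> * (c t - \<gamma>) + \<rho> t"
      using u[of t] t by (simp add: algebra_simps)
    also have "\<bar>\<dots>\<bar> \<le> \<bar>\<beta>\<bar> * \<bar>c t - \<gamma>\<bar> + \<bar>\<rho> t\<bar>"
      using abs_triangle_ineq[of "\<beta> * (c t - \<gamma>)" "\<rho> t"] by (simp add: abs_mult)
    also have "\<dots> \<le> \<bar>\<beta>\<bar> * (B * \<epsilon>) + B * \<epsilon>\<^sup>2"
      using \<gamma>[of t] \<rho>[of t] t ab by (intro add_mono) auto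
    finally show "\<bar>c t * u2 T \<alpha> \<epsilon> t + \<rho> t - \<gamma> * \<beta>\<bar> \<le> \<bar>\<beta>\<bar> * (B * \<epsilon>) + B * \<epsilon>\<^sup>2" .
  qed
  have p1: "\<bar>h \<epsilon> - h 0 - c0 * \<alpha> * (\<epsilon> - 0)\<bar> \<le> (\<bar>\<alpha>\<bar> * (B * \<epsilon>) + B * \<epsilon>\<^sup>2) * (\<epsilon> - 0)"
    using \<epsilon> c0 by (intro piece) (auto simp: u2_eq intro!: mult_left_mono)
  have p2: "\<bar>h (T / 2) - h \<epsilon> - 0 * 0 * (T / 2 - \<epsilon>)\<bar>
      \<le> (\<bar>0\<bar> * (B * \<epsilon>) + B * \<epsilon>\<^sup>2) * (T / 2 - \<epsilon>)"
    using \<epsilon> by (intro piece) (auto simp: u2_eq)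
  have p3: "\<bar>h (T / 2 + \<epsilon>) - h (T / 2) - c1 * (- \<alpha>) * (T / 2 + \<epsilon> - T / 2)\<bar>
      \<le> (\<bar>- \<alpha>\<bar> * (B * \<epsilon>) + B * \<epsilon>\<^sup>2) * (T / 2 + \<epsilon> - T / 2)"
    using \<epsilon> c1 by (intro piece) (auto simp: u2_eq intro!: mult_left_mono)
  have p4: "\<bar>h T - h (T / 2 + \<epsilon>) - 0 * 0 * (T - (T / 2 + \<epsilon>))\<bar>
      \<le> (\<bar>0\<bar> * (B * \<epsilon>) + B * \<epsilon>\<^sup>2) * (T - (T / 2 + \<epsilon>))"
    using \<epsilon> by (intro piece) (auto simp: u2_eq)
  have bound: "B * (2 * \<bar>\<alpha>\<bar> + T) * \<epsilon>\<^sup>2 =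
      (\<bar>\<alpha>\<bar> * (B * \<epsilon>) + B * \<epsilon>\<^sup>2) * (\<epsilon> - 0) + (\<bar>0\<bar> * (B * \<epsilon>) + B * \<epsilon>\<^sup>2) * (T / 2 - \<epsilon>)
      + (\<bar>- \<alpha>\<bar> * (B * \<epsilon>) + B * \<epsilon>\<^sup>2) * (T / 2 + \<epsilon> - T / 2)
      + (\<bar>0\<bar> * (B * \<epsilon>) + B * \<epsilon>\<^sup>2) * (T - (T / 2 + \<epsilon>))"
    by (simp add: algebra_simps power2_eq_square)
  have total: "h T - h 0 - \<alpha> * \<epsilon> * (c0 - c1) =
      (h \<epsilon> - h 0 - c0 * \<alpha> * (\<epsilon> - 0)) + (h (T / 2) - h \<epsilon> - 0 * 0 * (T / 2 - \<epsilon>))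
      + (h (T / 2 + \<epsilon>) - h (T / 2) - c1 * (- \<alpha>) * (T / 2 + \<epsilon> - T / 2))
      + (h T - h (T / 2 + \<epsilon>) - 0 * 0 * (T - (T / 2 + \<epsilon>)))"
    by (simp add: algebra_simps)
  show ?thesis
    unfolding bound total
    by (intro order_trans[OF abs_triangle_ineq] add_mono p1 p2 p3 p4)
qed

text \<open>Since \<open>F\<close> is only \<open>C\<^sup>1\<close>, a Taylor expansion of the flow would leave an error \<open>o(\<epsilon>)\<close>.
  In the coordinate \<open>g\<close> with \<open>g' = 1 / F\<close> the drift becomes \<open>u1\<close>, whose primitive vanishes at
  \<open>0\<close> and \<open>T\<close>.\<close>

lemma nonequilibrium_response:
  fixes F F' xs A :: "real \<Rightarrow> real"
  assumes D: "\<And>y. (F has_real_derivative F' y) (at y)" and cont: "continuous_on UNIV F'"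
    and T: "0 < T" and F0: "F x0 \<noteq> 0" and xs: "system_solution F (u1 T) (\<lambda>t. 0) x0 T xs"
    and A: "\<And>t. t \<in> {0..T} \<Longrightarrow> (A has_real_derivative F' (xs t)) (at t within {0..T})"
    and K: "0 < K"
  obtains M \<delta> where "0 < \<delta>"
    "\<And>\<epsilon> x. 0 < \<epsilon> \<Longrightarrow> \<epsilon> < T / 2 \<Longrightarrow> \<epsilon> \<le> \<delta> \<Longrightarrow> system_solution F (u1 T) (u2 T \<alpha> \<epsilon>) x0 T x \<Longrightarrow>
      (\<And>t. t \<in> {0..T} \<Longrightarrow> \<bar>x t - xs t\<bar> \<le> K * \<epsilon>) \<Longrightarrow>
      \<bar>x T - (x0 + \<epsilon> * \<alpha> * (1 - exp (A 0 - A (T / 2))))\<bar> \<le> M * \<epsilon>\<^sup>2"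
proof -
  obtain S where S: "finite S" "continuous_on {0..T} xs" "xs 0 = x0"
    "\<And>t. t \<in> {0<..<T} - S \<Longrightarrow> (xs has_real_derivative (F (xs t) * u1 T t + 0)) (at t)"
    using xs by (elim system_solutionE) blast
  have F: "continuous_on X F" for X
    using D by (auto intro!: continuous_at_imp_continuous_on DERIV_isCont)
  have A': "(A has_real_derivative F' (xs t)) (at t)" if "t \<in> {0<..<T}" for t
    using A[of t] that by (simp add: at_within_Icc_at)
  have A_cont: "continuous_on {0..T} A"
    using A by (rule DERIV_continuous_on)
  have Fxs: "((\<lambda>t. F (xs t)) has_real_derivative F' (xs t) * (F (xs t) * u1 T t)) (at t)"
    if "t \<in> {0<..<T} - S" for t
    using DERIV_chain2[OF D S(4)[OF that]] by simp
  have Fxs_cont: "continuous_on {0..T} (\<lambda>t. F (xs t))"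
    by (intro continuous_on_compose2[OF F[of UNIV] S(2)]) simp
  \<comment> \<open>\<open>F (xs t)\<close> solves a linear equation with coefficient
    \<open>F' (xs t) * u1 T t\<close>. The sign of \<open>u1\<close> decides whether
    \<open>exp (- A t)\<close> or \<open>exp (A t)\<close> turns it into a conserved quantity; hence
    \<open>F\<close> cannot reach zero along \<open>xs\<close>.\<close>
  have first: "F (xs t) * exp (- A t) = F (xs 0) * exp (- A 0)" if t: "t \<in> {0..T / 2}" for t
  proof (rule constant_if_deriv_zero[OF _ S(1), where f = "\<lambda>t. F (xs t) * exp (- A t)"])
    show "continuous_on {0..t} (\<lambda>t. F (xs t) * exp (- A t))"
      by (intro continuous_intros continuous_on_subset[OF Fxs_cont] continuous_on_subset[OF A_cont])
        (use t in auto)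
    fix s assume s: "s \<in> {0<..<t} - S"
    show "((\<lambda>t. F (xs t) * exp (- A t)) has_real_derivative 0) (at s)"
      using s t by (auto intro!: derivative_eq_intros Fxs A' simp: u1_eq)
  qed (use t in auto)
  have second: "F (xs t) * exp (A t) = F (xs (T / 2)) * exp (A (T / 2))" if t: "t \<in> {T / 2..T}" for t
  proof (rule constant_if_deriv_zero[OF _ S(1), where f = "\<lambda>t. F (xs t) * exp (A t)"])
    show "continuous_on {T / 2..t} (\<lambda>t. F (xs t) * exp (A t))"
      by (intro continuous_intros continuous_on_subset[OF Fxs_cont] continuous_on_subset[OF A_cont])
        (use t T in auto)
    fix s assume s: "s \<in> {T / 2<..<t} - S"
    then have "s \<in> {0<..<T} - S" using t T by auto
    then show "((\<lambda>t. F (xs t) * exp (A t)) has_real_derivative 0) (at s)"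
      using s t by (auto intro!: derivative_eq_intros Fxs A' simp: u1_eq)
  qed (use t in auto)
  have half: "F (xs (T / 2)) = F x0 * exp (A (T / 2) - A 0)"
    using first[of "T / 2"] T S(3) by (simp add: exp_minus exp_diff field_simps)
  have nz: "F (xs t) \<noteq> 0" if t: "t \<in> {0..T}" for t
  proof (cases "t \<le> T / 2")
    case True
    then show ?thesis using first[of t] t F0 S(3) by auto
  next
    case False
    then show ?thesis using second[of t] t F0 half by auto
  qed
  have "connected (xs ` {0..T})" "compact (xs ` {0..T})"
    using S(2) by (auto intro!: connected_continuous_image compact_continuous_image)
  then obtain p q where pq: "xs ` {0..T} = {p..q}"
    using connected_compact_interval_1 by blast
  have "open {y. F y \<noteq> 0}"
    using F[of UNIV] by (intro open_Collect_neq) auto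
  moreover have "{p..q} \<subseteq> {y. F y \<noteq> 0}"
    using nz by (auto simp: pq[symmetric])
  ultimately obtain e where e: "0 < e" "(\<Union>y\<in>{p..q}. ball y e) \<subseteq> {y. F y \<noteq> 0}"
    using compact_subset_open_imp_ball_epsilon_subset[of "{p..q}" "{y. F y \<noteq> 0}"] by auto
  \<comment> \<open>Half of \<open>e\<close>, so that the closed enlargement \<open>J\<close> of the
    range of \<open>xs\<close> still lies in the open \<open>e\<close>-neighbourhood where
    \<open>F\<close> has no zero.\<close>
  define R where "R = e / 2"
  define J where "J = {p - R..q + R}"
  have R: "0 < R" using e by (simp add: R_def)
  have "xs 0 \<in> {p..q}" using pq T by auto
  then have x0_pq: "p \<le> x0" "x0 \<le> q" using S(3) by auto
  have FJ: "F y \<noteq> 0" if "y \<in> J" for y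
  proof -
    \<comment> \<open>The point of \<open>{p..q}\<close> nearest to \<open>y\<close>.\<close>
    have "max p (min q y) \<in> {p..q}" "y \<in> ball (max p (min q y)) e"
      using that x0_pq e by (auto simp: J_def R_def dist_real_def)
    then show ?thesis using e(2) by blast
  qed
  have "continuous_on J (\<lambda>y. 1 / F y)"
    using FJ by (intro continuous_intros F) auto
  then obtain g where "\<And>y. y \<in> J \<Longrightarrow> (g has_vector_derivative 1 / F y) (at y within J)"
    unfolding J_def using antiderivative_continuous by blast
  then have g_within: "(g has_real_derivative 1 / F y) (at y within J)" if "y \<in> J" for y
    using that by (simp add: has_real_derivative_iff_has_vector_derivative)
  have g: "(g has_real_derivative 1 / F y) (at y)" if "y \<in> {p - R<..<q + R}" for y
    using g_within[of y] that by (simp add: J_def at_within_Icc_at)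
  have g_cont: "continuous_on J g"
    using g_within by (rule DERIV_continuous_on)
  \<comment> \<open>\<open>F\<close> being C^1 and nonzero on \<open>J\<close>, \<open>1 / F\<close>
    is Lipschitz there; this is the regularity that makes the kick error O(\<epsilon>^2).\<close>
  obtain C where C: "0 < C" "\<And>y z. y \<in> J \<Longrightarrow> z \<in> J \<Longrightarrow> \<bar>1 / F y - 1 / F z\<bar> \<le> C * \<bar>y - z\<bar>"
    unfolding J_def
  proof (rule lipschitz_on_interval)
    fix y assume "y \<in> {p - R..q + R}"
    then show "((\<lambda>y. 1 / F y) has_real_derivative - F' y / (F y)\<^sup>2) (at y within {p - R..q + R})"
      using FJ[of y] by (auto intro!: derivative_eq_intros has_field_derivative_at_within[OF D]
        simp: J_def power2_eq_square)
  next
    show "continuous_on {p - R..q + R} (\<lambda>y. - F' y / (F y)\<^sup>2)"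
      using FJ by (intro continuous_intros F continuous_on_subset[OF cont]) (auto simp: J_def)
  qed blast
  obtain L where L: "0 < L" "\<And>y z. y \<in> J \<Longrightarrow> z \<in> J \<Longrightarrow> \<bar>F y - F z\<bar> \<le> L * \<bar>y - z\<bar>"
    unfolding J_def
    by (rule lipschitz_on_interval[OF has_field_derivative_at_within[OF D]
          continuous_on_subset[OF cont]]) auto
  have "bounded (F ` J)"
    by (intro compact_imp_bounded compact_continuous_image F) (simp add: J_def)
  then obtain Q where Q: "0 < Q" "\<And>y. y \<in> J \<Longrightarrow> \<bar>F y\<bar> \<le> Q"
    by (force simp: bounded_pos)
  have xs_J: "xs t \<in> J" if "t \<in> {0..T}" for t
    using pq R that by (force simp: J_def)
  have xs_lip: "\<bar>xs b - xs a\<bar> \<le> Q * (b - a)" if ab: "0 \<le> a" "a \<le> b" "b \<le> T" for a b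
  proof -
    have "\<bar>xs b - xs a - 0 * (b - a)\<bar> \<le> Q * (b - a)"
    proof (rule increment_abs_le[OF ab(2) S(1)])
      show "continuous_on {a..b} xs" using ab by (intro continuous_on_subset[OF S(2)]) auto
      fix t assume t: "t \<in> {a<..<b} - S"
      with ab show "(xs has_real_derivative (F (xs t) * u1 T t + 0)) (at t)"
        by (intro S(4)) auto
      show "\<bar>F (xs t) * u1 T t + 0 - 0\<bar> \<le> Q"
        using Q(2)[OF xs_J, of t] t ab by (simp add: abs_mult abs_u1)
    qed
    then show ?thesis by simp
  qed
  define c0 where "c0 = 1 / F x0"
  define c1 where "c1 = 1 / F (xs (T / 2))"
  \<comment> \<open>\<open>K * \<epsilon>\<close> bounds the distance of \<open>x\<close> from
    \<open>xs\<close>, \<open>Q\<close> the speed of \<open>xs\<close>, and \<open>C\<close>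
    converts this into the variation of \<open>1 / F (x t)\<close> during a kick. \<open>M1\<close>
    is then the constant of \<open>kick_response\<close>, and \<open>M2\<close> will bound the
    change of \<open>g\<close> divided by \<epsilon>.\<close>
  define B where "B = C * (K + Q)"
  define M1 where "M1 = B * (2 * \<bar>\<alpha>\<bar> + T)"
  define M2 where "M2 = \<bar>\<alpha>\<bar> * \<bar>c0 - c1\<bar> + M1 * T"
  have B: "0 < B" using C K Q by (simp add: B_def)
  have M1: "0 \<le> M1" using B T by (simp add: M1_def)
  have M2: "0 \<le> M2" using M1 T by (simp add: M2_def)
  show ?thesis
  proof (rule that[of "R / (2 * K)" "L * Q * M2\<^sup>2 + Q * M1"])
    show "0 < R / (2 * K)" using R K by simp
    fix \<epsilon> x
    assume \<epsilon>: "0 < \<epsilon>" "\<epsilon> < T / 2" "\<epsilon> \<le> R / (2 * K)"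
      and x: "system_solution F (u1 T) (u2 T \<alpha> \<epsilon>) x0 T x"
      and close: "\<And>t. t \<in> {0..T} \<Longrightarrow> \<bar>x t - xs t\<bar> \<le> K * \<epsilon>"
    obtain S' where S': "finite S'" "continuous_on {0..T} x" "x 0 = x0"
      "\<And>t. t \<in> {0<..<T} - S' \<Longrightarrow> (x has_real_derivative (F (x t) * u1 T t + u2 T \<alpha> \<epsilon> t)) (at t)"
      using x by (elim system_solutionE) blast
    \<comment> \<open>The factor 2 in the bound on \<epsilon> makes this strict, so \<open>x\<close>
      remains in the interior of \<open>J\<close>, where \<open>g\<close> has two-sided
      derivatives.\<close>
    have "K * \<epsilon> < R" using \<epsilon>(3) K R by (simp add: field_simps)
    have x_J: "x t \<in> {p - R<..<q + R}" if "t \<in> {0..T}" for t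
    proof -
      have "xs t \<in> {p..q}" using pq that by auto
      with close[OF that] \<open>K * \<epsilon> < R\<close> show ?thesis by auto
    qed
    then have x_J': "x t \<in> J" if "t \<in> {0..T}" for t
      using that by (force simp: J_def)
    \<comment> \<open>Along \<open>x\<close> the drift moves \<open>g\<close> at rate exactly
      \<open>u1\<close>, so subtracting \<open>U1\<close> leaves the kicks scaled by
      \<open>1 / F (x t)\<close>, with zero remainder.\<close>
    define h where "h t = g (x t) - U1 T t" for t
    have "\<bar>h T - h 0 - \<alpha> * \<epsilon> * (c0 - c1)\<bar> \<le> B * (2 * \<bar>\<alpha>\<bar> + T) * \<epsilon>\<^sup>2"
    proof (rule kick_response[OF \<epsilon>(1,2)])
      show "finite (S' \<union> {T / 2})" using S' by simp
      show "continuous_on {0..T} h"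
        unfolding h_def using x_J'
        by (intro continuous_intros continuous_on_U1 continuous_on_compose2[OF g_cont S'(2)]) auto
      fix t assume t: "t \<in> {0<..<T} - (S' \<union> {T / 2})"
      have "((\<lambda>t. g (x t)) has_real_derivative
          1 / F (x t) * (F (x t) * u1 T t + u2 T \<alpha> \<epsilon> t)) (at t)"
        using t by (intro DERIV_chain2[OF g] S' x_J) auto
      then have "(h has_real_derivative
          1 / F (x t) * (F (x t) * u1 T t + u2 T \<alpha> \<epsilon> t) - u1 T t) (at t)"
        unfolding h_def using t by (intro DERIV_diff U1_has_derivative) auto
      then show "(h has_real_derivative 1 / F (x t) * u2 T \<alpha> \<epsilon> t + 0) (at t)"
        using FJ[OF x_J', of t] t by (simp add: algebra_simps)
    next
      fix t assume t: "t \<in> {0..\<epsilon>}"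
      have "\<bar>1 / F (x t) - c0\<bar> \<le> C * \<bar>x t - xs 0\<bar>"
        unfolding c0_def S(3)[symmetric] using t \<epsilon> by (intro C x_J' xs_J) auto
      also have "\<bar>x t - xs 0\<bar> \<le> K * \<epsilon> + Q * (t - 0)"
        using close[of t] xs_lip[of 0 t] t \<epsilon> by auto
      also have "\<dots> \<le> (K + Q) * \<epsilon>"
        using t Q by (simp add: algebra_simps)
      finally show "\<bar>1 / F (x t) - c0\<bar> \<le> B * \<epsilon>"
        using C by (simp add: B_def mult.assoc)
    next
      fix t assume t: "t \<in> {T / 2..T / 2 + \<epsilon>}"
      have "\<bar>1 / F (x t) - c1\<bar> \<le> C * \<bar>x t - xs (T / 2)\<bar>"
        unfolding c1_def using t \<epsilon> by (intro C x_J' xs_J) auto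
      also have "\<bar>x t - xs (T / 2)\<bar> \<le> K * \<epsilon> + Q * (t - T / 2)"
        using close[of t] xs_lip[of "T / 2" t] t \<epsilon> by auto
      also have "\<dots> \<le> (K + Q) * \<epsilon>"
        using mult_left_mono[of "t - T / 2" \<epsilon> Q] t Q by (simp add: algebra_simps)
      finally show "\<bar>1 / F (x t) - c1\<bar> \<le> B * \<epsilon>"
        using C by (simp add: B_def mult.assoc)
    qed (use B in auto)
    moreover define d where "d = g (x T) - g x0"
    ultimately have d: "\<bar>d - \<alpha> * \<epsilon> * (c0 - c1)\<bar> \<le> M1 * \<epsilon>\<^sup>2"
      using T by (simp add: h_def M1_def U1_def S'(3))
    have "\<bar>d\<bar> \<le> \<bar>\<alpha> * \<epsilon> * (c0 - c1)\<bar> + M1 * \<epsilon>\<^sup>2"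
      using d by linarith
    also have "M1 * \<epsilon>\<^sup>2 \<le> M1 * (T * \<epsilon>)"
      using \<epsilon> M1 by (intro mult_left_mono) (auto simp: power2_eq_square)
    also have "\<bar>\<alpha> * \<epsilon> * (c0 - c1)\<bar> = \<bar>\<alpha>\<bar> * \<bar>c0 - c1\<bar> * \<epsilon>"
      using \<epsilon> by (simp add: abs_mult)
    finally have d_le: "\<bar>d\<bar> \<le> M2 * \<epsilon>"
      by (simp add: M2_def distrib_right mult.assoc)
    \<comment> \<open>The mean value theorem for \<open>g\<close> translates back to the original
      coordinate. Replacing \<open>F \<xi>\<close> by \<open>F x0\<close> costs a Lipschitz constant
      times \<open>\<bar>\<xi> - x0\<bar> * \<bar>d\<bar>\<close>, both factors being O(\<epsilon>);
      no second derivative is involved.\<close>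
    obtain \<xi> where \<xi>: "x T - x0 = F \<xi> * d" "\<xi> \<in> J" "\<bar>\<xi> - x0\<bar> \<le> \<bar>x T - x0\<bar>"
    proof -
      have ends: "x T \<in> {p - R<..<q + R}" "x0 \<in> {p - R<..<q + R}"
        using x_J[of T] x_J[of 0] T S'(3) by auto
      consider "x0 < x T" | "x0 = x T" | "x T < x0" by linarith
      then show thesis
      proof cases
        case 1
        obtain z where z: "x0 < z" "z < x T" "g (x T) - g x0 = (x T - x0) * (1 / F z)"
          using MVT2[OF 1, of g "\<lambda>y. 1 / F y"] g ends by auto
        then show thesis
          using ends FJ[of z] by (intro that[of z]) (auto simp: J_def d_def)
      next
        case 2
        then show thesis using ends by (intro that[of x0]) (auto simp: J_def d_def)
      next
        case 3
        obtain z where z: "x T < z" "z < x0" "g x0 - g (x T) = (x0 - x T) * (1 / F z)"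
          using MVT2[OF 3, of g "\<lambda>y. 1 / F y"] g ends by auto
        then show thesis
          using ends FJ[of z] by (intro that[of z]) (auto simp: J_def d_def field_simps)
      qed
    qed
    have "\<bar>x T - x0\<bar> \<le> Q * \<bar>d\<bar>"
      unfolding \<xi>(1) abs_mult using Q(2)[OF \<xi>(2)] by (intro mult_right_mono) auto
    moreover have "\<bar>F \<xi> - F x0\<bar> \<le> L * \<bar>\<xi> - x0\<bar>"
      using \<xi>(2) xs_J[of 0] T S(3) by (intro L) auto
    ultimately have "\<bar>F \<xi> - F x0\<bar> \<le> L * (Q * \<bar>d\<bar>)"
      using \<xi>(3) L(1) by (smt (verit) mult_left_mono)
    then have "\<bar>F \<xi> - F x0\<bar> * \<bar>d\<bar> \<le> L * (Q * \<bar>d\<bar>) * \<bar>d\<bar>"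
      by (intro mult_right_mono) auto
    also have "\<dots> = L * Q * \<bar>d\<bar>\<^sup>2" by (simp add: power2_eq_square)
    also have "\<dots> \<le> L * Q * (M2 * \<epsilon>)\<^sup>2"
      using d_le L(1) Q(1) by (intro mult_left_mono power_mono) auto
    finally have 1: "\<bar>x T - x0 - F x0 * d\<bar> \<le> L * Q * M2\<^sup>2 * \<epsilon>\<^sup>2"
      by (simp add: \<xi>(1) left_diff_distrib[symmetric] abs_mult power_mult_distrib)
    have "\<bar>F x0\<bar> * \<bar>d - \<alpha> * \<epsilon> * (c0 - c1)\<bar> \<le> Q * (M1 * \<epsilon>\<^sup>2)"
      using Q(2)[OF xs_J, of 0] T S(3) d Q(1) by (intro mult_mono) auto
    then have 2: "\<bar>F x0 * d - F x0 * (\<alpha> * \<epsilon> * (c0 - c1))\<bar> \<le> Q * M1 * \<epsilon>\<^sup>2"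
      by (simp add: abs_mult[symmetric] right_diff_distrib mult.assoc)
    have "F x0 * (c0 - c1) = 1 - exp (A 0 - A (T / 2))"
      using F0 by (simp add: c0_def c1_def half exp_diff field_simps)
    then have "F x0 * (\<alpha> * \<epsilon> * (c0 - c1)) = \<epsilon> * \<alpha> * (1 - exp (A 0 - A (T / 2)))"
      by (metis mult.assoc mult.commute)
    with 1 2 show "\<bar>x T - (x0 + \<epsilon> * \<alpha> * (1 - exp (A 0 - A (T / 2))))\<bar>
        \<le> (L * Q * M2\<^sup>2 + Q * M1) * \<epsilon>\<^sup>2"
      unfolding distrib_right by linarith
  qed
qed

lemma equilibrium_response:
  fixes F F' xs A :: "real \<Rightarrow> real"
  assumes D: "\<And>y. (F has_real_derivative F' y) (at y)" and cont: "continuous_on UNIV F'"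
    and T: "0 < T" and F0: "F x0 = 0" and xs: "system_solution F (u1 T) (\<lambda>t. 0) x0 T xs"
    and A: "\<And>t. t \<in> {0..T} \<Longrightarrow> (A has_real_derivative F' (xs t)) (at t within {0..T})"
    and O: "(\<lambda>x. F x - F' x0 * (x - x0)) \<in> O[at x0](\<lambda>x. (x - x0)\<^sup>2)"
    and K: "0 < K"
  obtains M \<delta> where "0 < \<delta>"
    "\<And>\<epsilon> x. 0 < \<epsilon> \<Longrightarrow> \<epsilon> < T / 2 \<Longrightarrow> \<epsilon> \<le> \<delta> \<Longrightarrow> system_solution F (u1 T) (u2 T \<alpha> \<epsilon>) x0 T x \<Longrightarrow>
      (\<And>t. t \<in> {0..T} \<Longrightarrow> \<bar>x t - xs t\<bar> \<le> K * \<epsilon>) \<Longrightarrow>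
      \<bar>x T - (x0 + \<epsilon> * \<alpha> * (1 - exp (A 0 - A (T / 2))))\<bar> \<le> M * \<epsilon>\<^sup>2"
proof -
  define l where "l = F' x0"
  have "system_solution F (u1 T) (\<lambda>t. 0) x0 T (\<lambda>_. x0)"
    by (rule system_solutionI[where S = "{}"]) (auto simp: F0)
  then have xs_eq: "xs t = x0" if "t \<in> {0..T}" for t
    by (intro system_solution_unique[OF D cont _ xs _ that]) (auto simp: abs_u1)
  \<comment> \<open>With bound \<open>0\<close> the increment estimate is an equality: along the
    constant solution \<open>A\<close> has slope \<open>l\<close>.\<close>
  have "\<bar>A (T / 2) - A 0 - l * (T / 2 - 0)\<bar> \<le> 0 * (T / 2 - 0)"
  proof (rule increment_abs_le[where S = "{}"])
    show "continuous_on {0..T / 2} A"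
      by (rule continuous_on_subset[OF DERIV_continuous_on[OF A]]) (use T in auto)
    fix t assume t: "t \<in> {0<..<T / 2} - {}"
    then show "(A has_real_derivative l) (at t)"
      using A[of t] xs_eq[of t] T by (simp add: at_within_Icc_at l_def)
  qed (use T in auto)
  then have half: "A 0 - A (T / 2) = - l * (T / 2)" by simp
  obtain C where C: "0 < C" "\<forall>\<^sub>F y in at x0. norm (F y - F' x0 * (y - x0)) \<le> C * norm ((y - x0)\<^sup>2)"
    using O by (elim landau_o.bigE) blast
  then obtain r where r: "0 < r"
    "\<And>y. y \<noteq> x0 \<Longrightarrow> dist y x0 < r \<Longrightarrow> \<bar>F y - l * (y - x0)\<bar> \<le> C * (y - x0)\<^sup>2"
    unfolding eventually_at by (auto simp: l_def)
  \<comment> \<open>The filter \<open>at x0\<close> leaves out \<open>x0\<close> itself, where the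
    estimate holds because \<open>F x0 = 0\<close>.\<close>
  have quad: "\<bar>F y - l * (y - x0)\<bar> \<le> C * (y - x0)\<^sup>2" if "\<bar>y - x0\<bar> < r" for y
    using r(2)[of y] that by (cases "y = x0") (auto simp: F0 dist_real_def)
  obtain L where L: "0 < L"
    "\<And>y z. y \<in> {0..T} \<Longrightarrow> z \<in> {0..T} \<Longrightarrow> \<bar>exp (- l * y) - exp (- l * z)\<bar> \<le> L * \<bar>y - z\<bar>"
    by (rule lipschitz_on_interval[of 0 T "\<lambda>y. exp (- l * y)" "\<lambda>y. - l * exp (- l * y)"])
      (auto intro!: derivative_eq_intros continuous_intros)
  have "bounded ((\<lambda>y. exp (- l * y)) ` {0..T})"
    by (intro compact_imp_bounded compact_continuous_image continuous_intros) auto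
  then obtain E where E: "0 < E" "\<And>y. y \<in> {0..T} \<Longrightarrow> exp (- l * y) \<le> E"
    by (force simp: bounded_pos)
  \<comment> \<open>The first summand bounds the remainder \<open>\<rho>\<close>, the second the
    variation of the integrating factor during a kick, as \<open>U1\<close> has unit speed.\<close>
  define B where "B = E * C * K\<^sup>2 + L"
  show ?thesis
  proof (rule that[of "r / (2 * K)" "B * (2 * \<bar>\<alpha>\<bar> + T)"])
    show "0 < r / (2 * K)" using r K by simp
    fix \<epsilon> x
    assume \<epsilon>: "0 < \<epsilon>" "\<epsilon> < T / 2" "\<epsilon> \<le> r / (2 * K)"
      and x: "system_solution F (u1 T) (u2 T \<alpha> \<epsilon>) x0 T x"
      and close: "\<And>t. t \<in> {0..T} \<Longrightarrow> \<bar>x t - xs t\<bar> \<le> K * \<epsilon>"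
    obtain S where S: "finite S" "continuous_on {0..T} x" "x 0 = x0"
      "\<And>t. t \<in> {0<..<T} - S \<Longrightarrow> (x has_real_derivative (F (x t) * u1 T t + u2 T \<alpha> \<epsilon> t)) (at t)"
      using x by (elim system_solutionE) blast
    have "K * \<epsilon> < r" using \<epsilon>(3) K r(1) by (simp add: field_simps)
    define h where "h t = exp (- l * U1 T t) * (x t - x0)" for t
    define \<rho> where "\<rho> t = exp (- l * U1 T t) * (u1 T t * (F (x t) - l * (x t - x0)))" for t
    have U1: "U1 T t \<in> {0..T}" if "t \<in> {0..T}" for t
      using that by (auto simp: U1_def)
    have "\<bar>h T - h 0 - \<alpha> * \<epsilon> * (1 - exp (- l * (T / 2)))\<bar> \<le> B * (2 * \<bar>\<alpha>\<bar> + T) * \<epsilon>\<^sup>2"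
    proof (rule kick_response[OF \<epsilon>(1,2)])
      show "finite (S \<union> {T / 2})" using S by simp
      show "continuous_on {0..T} h"
        unfolding h_def by (intro continuous_intros continuous_on_U1 S)
      fix t assume t: "t \<in> {0<..<T} - (S \<union> {T / 2})"
      have "(U1 T has_real_derivative u1 T t) (at t)"
        "(x has_real_derivative (F (x t) * u1 T t + u2 T \<alpha> \<epsilon> t)) (at t)"
        using t by (auto intro!: U1_has_derivative S)
      then show "(h has_real_derivative exp (- l * U1 T t) * u2 T \<alpha> \<epsilon> t + \<rho> t) (at t)"
        unfolding h_def \<rho>_def by (auto intro!: derivative_eq_intros simp: algebra_simps)
    next
      fix t assume t: "t \<in> {0..T}"
      then have c: "\<bar>x t - x0\<bar> \<le> K * \<epsilon>" using close xs_eq by force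
      then have "\<bar>F (x t) - l * (x t - x0)\<bar> \<le> C * (x t - x0)\<^sup>2"
        using \<open>K * \<epsilon> < r\<close> by (intro quad) linarith
      also have "\<dots> = C * \<bar>x t - x0\<bar>\<^sup>2" by simp
      also have "\<dots> \<le> C * (K * \<epsilon>)\<^sup>2"
        using c C by (intro mult_left_mono power_mono) auto
      finally have "\<bar>\<rho> t\<bar> \<le> E * (C * (K * \<epsilon>)\<^sup>2)"
        unfolding \<rho>_def abs_mult abs_u1 using E(2)[OF U1[OF t]] E(1) by (simp add: mult_mono)
      also have "\<dots> \<le> B * \<epsilon>\<^sup>2"
        using L(1) by (simp add: B_def algebra_simps power_mult_distrib)
      finally show "\<bar>\<rho> t\<bar> \<le> B * \<epsilon>\<^sup>2" .
    next
      fix t assume t: "t \<in> {0..\<epsilon>}"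
      have "\<bar>exp (- l * U1 T t) - exp (- l * 0)\<bar> \<le> L * \<bar>U1 T t - 0\<bar>"
        using t \<epsilon> by (intro L U1) auto
      also have "\<dots> \<le> B * \<epsilon>"
        using t \<epsilon> L(1) E(1) C(1) by (intro mult_mono) (auto simp: B_def U1_def)
      finally show "\<bar>exp (- l * U1 T t) - 1\<bar> \<le> B * \<epsilon>" by simp
    next
      fix t assume t: "t \<in> {T / 2..T / 2 + \<epsilon>}"
      have "\<bar>exp (- l * U1 T t) - exp (- l * (T / 2))\<bar> \<le> L * \<bar>U1 T t - T / 2\<bar>"
        using t \<epsilon> by (intro L U1) auto
      also have "\<dots> \<le> B * \<epsilon>"
        using t \<epsilon> L(1) E(1) C(1) by (intro mult_mono) (auto simp: B_def U1_def min_def)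
      finally show "\<bar>exp (- l * U1 T t) - exp (- l * (T / 2))\<bar> \<le> B * \<epsilon>" .
    qed
    then show "\<bar>x T - (x0 + \<epsilon> * \<alpha> * (1 - exp (A 0 - A (T / 2))))\<bar>
        \<le> B * (2 * \<bar>\<alpha>\<bar> + T) * \<epsilon>\<^sup>2"
      unfolding half using T by (simp add: h_def U1_def S(3) algebra_simps)
  qed
qed

section \<open>The state-transition matrix and the conclusion\<close>

lemma state_transition_eq_exp:
  assumes \<Phi>: "state_transition a I \<Phi>"
    and A: "\<And>t. t \<in> I \<Longrightarrow> (A has_real_derivative a t) (at t within I)"
    and t: "t \<in> I" "t0 \<in> I"
  shows "\<Phi> t t0 = exp (A t - A t0)"
proof -
  \<comment> \<open>This solution vanishes nowhere, so its values alone determine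
    \<open>\<Phi>\<close> on \<open>I\<close>.\<close>
  have "\<forall>t\<in>I. ((\<lambda>t. exp (A t)) has_real_derivative a t * exp (A t)) (at t within I)"
    by (auto intro!: derivative_eq_intros A)
  then have "exp (A t) = \<Phi> t t0 * exp (A t0)"
    using \<Phi> t unfolding state_transition_def by blast
  then show ?thesis by (simp add: exp_diff)
qed

lemma integral_state_transition:
  assumes a: "continuous_on {b..c} a" and bc: "b \<le> c"
    and A: "\<And>t. t \<in> {b..c} \<Longrightarrow> (A has_real_derivative a t) (at t within {b..c})"
    and \<Phi>: "\<And>t. t \<in> {b..c} \<Longrightarrow> \<Phi> t = exp (A t - A c)"
  shows "(LBINT t=b..c. a t * \<Phi> t) = 1 - exp (A b - A c)"
proof -
  have "(LBINT t=b..c. a t * \<Phi> t) = (LBINT t=b..c. a t * exp (A t - A c))"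
    using bc by (intro interval_integral_cong) (auto simp: einterval_iff \<Phi>)
  also have "\<dots> = exp (A c - A c) - exp (A b - A c)"
  proof (rule interval_integral_FTC_finite)
    show "continuous_on {min b c..max b c} (\<lambda>t. a t * exp (A t - A c))"
      using bc DERIV_continuous_on[OF A] a by (auto intro!: continuous_intros)
    fix t assume "min b c \<le> t" "t \<le> max b c"
    then show "((\<lambda>t. exp (A t - A c)) has_vector_derivative a t * exp (A t - A c))
        (at t within {min b c..max b c})"
      using bc A[of t] by (auto intro!: derivative_eq_intros
        simp: has_real_derivative_iff_has_vector_derivative[symmetric])
  qed
  finally show ?thesis by simp
qed

theorem theorem1:
  fixes F :: "real \<Rightarrow> real" and x0 T \<alpha> :: real
    and xs :: "real \<Rightarrow> real" and \<Phi> :: "real \<Rightarrow> real \<Rightarrow> real"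
  assumes F_C1: "F C1_differentiable_on UNIV"
    and T_pos: "0 < T"
    and xs: "system_solution F (u1 T) (\<lambda>t. 0) x0 T xs"
    and \<Phi>: "state_transition (\<lambda>t. deriv F (xs t)) {0..T} \<Phi>"
    and F_equilibrium:
      "F x0 = 0 \<Longrightarrow> (\<lambda>x. F x - deriv F x0 * (x - x0)) \<in> O[at x0](\<lambda>x. (x - x0)\<^sup>2)"
  shows "\<exists>M>0. \<exists>\<delta>>0. \<forall>\<epsilon>. 0 < \<epsilon> \<and> \<epsilon> < T / 2 \<and> \<epsilon> \<le> \<delta> \<longrightarrow>
    (\<exists>x. system_solution F (u1 T) (u2 T \<alpha> \<epsilon>) x0 T x) \<and>
    (\<forall>x. system_solution F (u1 T) (u2 T \<alpha> \<epsilon>) x0 T x \<longrightarrow>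
      \<bar>x T - (x0 + \<epsilon> * \<alpha> * \<Phi> 0 \<epsilon> *
          (LBINT \<tau>=\<epsilon>..T / 2 - \<epsilon>. deriv F (xs \<tau>) * \<Phi> \<tau> (T / 2 - \<epsilon>)))\<bar>
        \<le> M * \<bar>\<epsilon>\<^sup>2\<bar>)"
proof -
  obtain F' where D': "\<And>y. (F has_real_derivative F' y) (at y)" and cont': "continuous_on UNIV F'"
    using F_C1
    by (auto simp: C1_differentiable_on_def has_real_derivative_iff_has_vector_derivative)
  have "deriv F = F'" using D' by (auto intro: DERIV_imp_deriv)
  note D = D'[folded this] and cont = cont'[folded this]
  have a_cont: "continuous_on {0..T} (\<lambda>t. deriv F (xs t))"
    using xs by (intro continuous_on_compose2[OF cont]) (auto simp: system_solution_def)
  then obtain A where "\<And>t. t \<in> {0..T} \<Longrightarrow> (A has_vector_derivative deriv F (xs t)) (at t within {0..T})"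
    using antiderivative_continuous by blast
  then have A: "(A has_real_derivative deriv F (xs t)) (at t within {0..T})" if "t \<in> {0..T}" for t
    using that by (simp add: has_real_derivative_iff_has_vector_derivative)
  have \<Phi>_eq: "\<Phi> t t0 = exp (A t - A t0)" if "t \<in> {0..T}" "t0 \<in> {0..T}" for t t0
    by (rule state_transition_eq_exp[OF \<Phi> A that])
  \<comment> \<open>This is \<open>\<Phi> 0 t\<close>. The coefficient in the claim telescopes to
    \<open>q \<epsilon> - q (T / 2 - \<epsilon>)\<close>, and two Lipschitz steps of length
    \<epsilon> lead to \<open>q 0 - q (T / 2)\<close>.\<close>
  define q where "q t = exp (A 0 - A t)" for t
  obtain L where L: "0 < L" "\<And>y z. y \<in> {0..T} \<Longrightarrow> z \<in> {0..T} \<Longrightarrow> \<bar>q y - q z\<bar> \<le> L * \<bar>y - z\<bar>"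
    unfolding q_def
    by (rule lipschitz_on_interval[of 0 T "\<lambda>t. exp (A 0 - A t)" "\<lambda>t. exp (A 0 - A t) * - deriv F (xs t)"])
      (auto intro!: derivative_eq_intros continuous_intros a_cont A DERIV_continuous_on[OF A])
  \<comment> \<open>The restriction \<open>\<epsilon> \<le> T / 4\<close> keeps the limits of
    integration in order.\<close>
  have leading: "\<bar>\<Phi> 0 \<epsilon> * (LBINT \<tau>=\<epsilon>..T / 2 - \<epsilon>. deriv F (xs \<tau>) * \<Phi> \<tau> (T / 2 - \<epsilon>)) - (1 - q (T / 2))\<bar>
      \<le> 2 * L * \<epsilon>" if \<epsilon>: "0 < \<epsilon>" "\<epsilon> \<le> T / 4" for \<epsilon>
  proof -
    have sub: "{\<epsilon>..T / 2 - \<epsilon>} \<subseteq> {0..T}" using \<epsilon> by auto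
    have "(LBINT \<tau>=\<epsilon>..T / 2 - \<epsilon>. deriv F (xs \<tau>) * \<Phi> \<tau> (T / 2 - \<epsilon>)) = 1 - exp (A \<epsilon> - A (T / 2 - \<epsilon>))"
    proof (rule integral_state_transition)
      show "continuous_on {\<epsilon>..T / 2 - \<epsilon>} (\<lambda>t. deriv F (xs t))"
        by (rule continuous_on_subset[OF a_cont sub])
      fix t assume t: "t \<in> {\<epsilon>..T / 2 - \<epsilon>}"
      show "(A has_real_derivative deriv F (xs t)) (at t within {\<epsilon>..T / 2 - \<epsilon>})"
        by (rule DERIV_subset[OF A sub]) (use t sub in auto)
      show "\<Phi> t (T / 2 - \<epsilon>) = exp (A t - A (T / 2 - \<epsilon>))"
        using t \<epsilon> by (intro \<Phi>_eq) auto
    qed (use \<epsilon> in auto)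
    moreover have "\<Phi> 0 \<epsilon> = exp (A 0 - A \<epsilon>)"
      using \<epsilon> by (intro \<Phi>_eq) auto
    moreover have "exp (A 0 - A \<epsilon>) * (1 - exp (A \<epsilon> - A (T / 2 - \<epsilon>))) = q \<epsilon> - q (T / 2 - \<epsilon>)"
      by (simp add: q_def right_diff_distrib flip: exp_add)
    ultimately have "\<Phi> 0 \<epsilon> * (LBINT \<tau>=\<epsilon>..T / 2 - \<epsilon>. deriv F (xs \<tau>) * \<Phi> \<tau> (T / 2 - \<epsilon>)) = q \<epsilon> - q (T / 2 - \<epsilon>)"
      by simp
    moreover have "q 0 = 1" by (simp add: q_def)
    moreover have "\<bar>q \<epsilon> - q 0\<bar> \<le> L * \<bar>\<epsilon> - 0\<bar>" "\<bar>q (T / 2) - q (T / 2 - \<epsilon>)\<bar> \<le> L * \<bar>T / 2 - (T / 2 - \<epsilon>)\<bar>"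
      using \<epsilon> by (intro L(2); auto)+
    ultimately show ?thesis using \<epsilon> by simp
  qed
  obtain K \<delta>1 where K: "0 < K" "0 < \<delta>1"
    "\<And>\<epsilon>. 0 < \<epsilon> \<Longrightarrow> \<epsilon> < T / 2 \<Longrightarrow> \<epsilon> \<le> \<delta>1 \<Longrightarrow> \<exists>x. system_solution F (u1 T) (u2 T \<alpha> \<epsilon>) x0 T x"
    "\<And>\<epsilon> x t. 0 < \<epsilon> \<Longrightarrow> \<epsilon> < T / 2 \<Longrightarrow> \<epsilon> \<le> \<delta>1 \<Longrightarrow> system_solution F (u1 T) (u2 T \<alpha> \<epsilon>) x0 T x \<Longrightarrow>
      t \<in> {0..T} \<Longrightarrow> \<bar>x t - xs t\<bar> \<le> K * \<epsilon>"
    by (rule perturbed_solution[OF D cont T_pos xs, of \<alpha>]) blast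
  obtain M \<delta>2 where M: "0 < \<delta>2"
    "\<And>\<epsilon> x. 0 < \<epsilon> \<Longrightarrow> \<epsilon> < T / 2 \<Longrightarrow> \<epsilon> \<le> \<delta>2 \<Longrightarrow> system_solution F (u1 T) (u2 T \<alpha> \<epsilon>) x0 T x \<Longrightarrow>
      (\<And>t. t \<in> {0..T} \<Longrightarrow> \<bar>x t - xs t\<bar> \<le> K * \<epsilon>) \<Longrightarrow>
      \<bar>x T - (x0 + \<epsilon> * \<alpha> * (1 - q (T / 2)))\<bar> \<le> M * \<epsilon>\<^sup>2"
  proof (cases "F x0 = 0")
    case True
    show thesis
      by (rule equilibrium_response[OF D cont T_pos True xs A F_equilibrium[OF True] K(1), where \<alpha> = \<alpha>])
        (use that in \<open>auto simp: q_def\<close>)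
  next
    case False
    show thesis
      by (rule nonequilibrium_response[OF D cont T_pos False xs A K(1), where \<alpha> = \<alpha>])
        (use that in \<open>auto simp: q_def\<close>)
  qed
  \<comment> \<open>\<open>\<bar>M\<bar>\<close> covers the response error, the sign of
    \<open>M\<close> being unknown; the second summand covers the replacement of the coefficient by
    \<open>1 - q (T / 2)\<close>; the last ensures positivity.\<close>
  define N where "N = \<bar>M\<bar> + \<bar>\<alpha>\<bar> * (2 * L) + 1"
  define \<delta> where "\<delta> = min (T / 4) (min \<delta>1 \<delta>2)"
  have "0 < N" using L(1) by (simp add: N_def add_nonneg_pos)
  moreover have "0 < \<delta>" using T_pos K(2) M(1) by (simp add: \<delta>_def)
  moreover have "\<bar>x T - (x0 + \<epsilon> * \<alpha> * \<Phi> 0 \<epsilon> *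
      (LBINT \<tau>=\<epsilon>..T / 2 - \<epsilon>. deriv F (xs \<tau>) * \<Phi> \<tau> (T / 2 - \<epsilon>)))\<bar> \<le> N * \<bar>\<epsilon>\<^sup>2\<bar>"
    if \<epsilon>: "0 < \<epsilon>" "\<epsilon> < T / 2" "\<epsilon> \<le> \<delta>" and x: "system_solution F (u1 T) (u2 T \<alpha> \<epsilon>) x0 T x" for \<epsilon> x
  proof -
    define Y where "Y = \<Phi> 0 \<epsilon> * (LBINT \<tau>=\<epsilon>..T / 2 - \<epsilon>. deriv F (xs \<tau>) * \<Phi> \<tau> (T / 2 - \<epsilon>))"
    have le: "\<epsilon> \<le> T / 4" "\<epsilon> \<le> \<delta>1" "\<epsilon> \<le> \<delta>2" using \<epsilon>(3) by (auto simp: \<delta>_def)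
    have 1: "\<bar>x T - (x0 + \<epsilon> * \<alpha> * (1 - q (T / 2)))\<bar> \<le> M * \<epsilon>\<^sup>2"
      by (rule M(2)[OF \<epsilon>(1,2) le(3) x K(4)[OF \<epsilon>(1,2) le(2) x]])
    have "\<bar>\<epsilon> * \<alpha> * Y - \<epsilon> * \<alpha> * (1 - q (T / 2))\<bar> = \<epsilon> * \<bar>\<alpha>\<bar> * \<bar>Y - (1 - q (T / 2))\<bar>"
      using \<epsilon> by (simp add: abs_mult flip: right_diff_distrib)
    also have "\<dots> \<le> \<epsilon> * \<bar>\<alpha>\<bar> * (2 * L * \<epsilon>)"
      unfolding Y_def using \<epsilon> le by (intro mult_left_mono leading) auto
    also have "\<dots> = \<bar>\<alpha>\<bar> * (2 * L) * \<epsilon>\<^sup>2" by (simp add: power2_eq_square)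
    finally have "\<bar>x T - (x0 + \<epsilon> * \<alpha> * Y)\<bar> \<le> M * \<epsilon>\<^sup>2 + \<bar>\<alpha>\<bar> * (2 * L) * \<epsilon>\<^sup>2"
      using 1 by linarith
    also have "\<dots> \<le> N * \<bar>\<epsilon>\<^sup>2\<bar>"
      unfolding distrib_right[symmetric] abs_power2
      by (rule mult_right_mono) (auto simp: N_def)
    finally show ?thesis by (simp add: Y_def mult.assoc)
  qed
  moreover have "\<exists>x. system_solution F (u1 T) (u2 T \<alpha> \<epsilon>) x0 T x"
    if "0 < \<epsilon>" "\<epsilon> < T / 2" "\<epsilon> \<le> \<delta>" for \<epsilon>
    using that by (intro K(3)) (auto simp: \<delta>_def)
  ultimately show ?thesis by blast
qed

end
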